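(* Suppose the likelihood ratio $\mathrm{LR}$ has finite variation, that $\mathrm{LR}$ and $F$ are non-differentiable at only finitely many points, and that for every $t\in[0,T]$ the finite partition condition on $\frac{\partial\phi_\lambda}{\partial y}(t,\cdot)$ stated in the context (Assumption A3) holds. Suppose $F$ is strictly increasing. Fix $t\in[0,T]$ and $\lambda\in\mathbb{R}$, and let $0=y_0<y_1<\cdots<y_{m_t}<y_{m_t+1}=\infty$, the intervals $S_{i,j_i}=[y_{i-1},y_i)$ and the types $j_i\in\{1,2,3\}$ ($i=1,\dots,m_t+1$) be the partition described in the context. Consider the problem $$\inf_{I\in\mathcal C}\Big\{(1+\theta)\mathbb E^{\mathbb Q}[I(Y)]+\tfrac{\gamma e^{r(T-t)}}{2}\mathbb E[I(Y)^2]-\gamma e^{r(T-t)}\mathbb E[Y I(Y)]-\lambda\,\mathbb E[I(Y)]\Big\}.$$ Then the optimal indemnity function $I^*(t,\cdot)$ of this problem has the following form. Write $Z_{(a,b]}(x)=(x-a)_+-(x-b)_+$. On the last interval $S_{m_t+1,j_{m_t+1}}$: (i) if $j_{m_t+1}=1$, then $I^*(t,y)=I^*(t,y_{m_t})+(y-s_{m_t+1})_+$ for some $s_{m_t+1}\in[y_{m_t},\infty)$; (ii) if $j_{m_t+1}=2$, then $I^*(t,y)=\min\{I^*(t,y_{m_t})+y-y_{m_t},\ \max\{I^*(t,y_{m_t}),\phi_\lambda(t,y)\}\}$; (iii) if $j_{m_t+1}=3$, then $I^*(t,y)=I^*(t,y_{m_t})+Z_{(y_{m_t},s_{m_t+1}]}(y)$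 for some $s_{m_t+1}\in[y_{m_t},\infty)$. On $S_{i,j_i}$ for $i=1,\dots,m_t$: (iv) if $j_i=1$, then $I^*(t,y)=I^*(t,y_{i-1})+Z_{(s_i,\,s_i+I^*(t,y_i)-I^*(t,y_{i-1})]}(y)$ for some $s_i\in[y_{i-1},y_i]$; (v) if $j_i=2$, then $I^*(t,y)=\min\{\max\{\phi_\lambda(t,y),\ I^*(t,y_i)+y-y_i,\ I^*(t,y_{i-1})\},\ I^*(t,y_{i-1})+y-y_{i-1},\ I^*(t,y_i)\}$; (vi) if $j_i=3$, then $I^*(t,y)=I^*(t,y_{i-1})+y-y_{i-1}-Z_{(s_i,\,s_i+y_i-y_{i-1}-I^*(t,y_i)+I^*(t,y_{i-1})]}(y)$ for some $s_i\in[y_{i-1},y_i]$.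
   Context: Constants: $T>0$, $r>0$, $\gamma>0$, $\theta\ge 0$. $Y$ is a nonnegative random variable (claim size; point masses, e.g. at zero, are allowed) considered under two probability measures $\mathbb P$ (insurer) and $\mathbb Q$ (reinsurer), with finite first and second moments under both. $F$ and $F^{\mathbb Q}$ are the distribution functions of $Y$ under $\mathbb P$ and $\mathbb Q$; $\mathbb E$ is expectation under $\mathbb P$, $\mathbb E^{\mathbb Q}$ under $\mathbb Q$. $x_+=\max\{x,0\}$. $\mathcal C:=\{f:\mathbb R_+\to\mathbb R_+ \mid f(0)=0,\ 0\le f(y)-f(x)\le y-x\ \text{for all } x\le y\}$. A Borel function $\mathrm{LR}\ge 0$ is a likelihood ratio of $\mathbb Q$ against $\mathbb P$ if $\mathbb Q(Y\in E\cap\{\mathrm{LR}<\infty\})=\int_E \mathrm{LR}(y)\,dF(y)$ for all Borel $E$. $\phi_\lambda(t,y):=y+\dfrac{\lambda-(1+\theta)\mathrm{LR}(y)}{\gamma e^{r(T-t)}}$. Note that $\partial\phi_\lambda/\partial y$ does not depend on $\lambda$. Assumption A3: let $0=y_0'\le y_1'<\cdots<y_n'<\infty$ where $y_1',\dots,y_n'$ are the points of non-differentiability of $\mathrm{LR}$ or $F$. For any $t\in[0,T]$, each interval $(y'_{i-1},y'_i)$, $i=1,\dots,n$, and $(y'_n,\infty)$ can be partitioned into finitely many disjoint sub-intervals on each of which exactly one of the following holds throughout: $\frac{\partial\phi_\lambda}{\partial y}(t,y)>1$; $\frac{\partial\phi_\lambda}{\partial y}(t,y)\in[0,1]$; $\frac{\partial\phi_\lambda}{\partial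 y}(t,y)<0$. Partition: for fixed $t$, $0=y_0<y_1<\cdots<y_{m_t}$ is the strictly increasing sequence consisting of $0$ together with all the endpoints of these sub-intervals (in particular all the points $y_i'$), and $y_{m_t+1}=\infty$. Put $S_{i,j_i}=[y_{i-1},y_i)$ with $j_i=1$ if $\frac{\partial\phi_\lambda}{\partial y}(t,y)>1$ on $(y_{i-1},y_i)$, $j_i=2$ if $\frac{\partial\phi_\lambda}{\partial y}(t,y)\in[0,1]$ on $(y_{i-1},y_i)$, and $j_i=3$ if $\frac{\partial\phi_\lambda}{\partial y}(t,y)<0$ on $(y_{i-1},y_i)$. The values $I^*(t,y_i)$ appearing in the formulas are the values of the optimal function itself at the partition points (they are not determined by the theorem). *)

theory Defs
  imports "HOL-Probability.Probability"
begin

text \<open>Functions on the half-line \<open>[0, \<infinity>)\<close> are represented by functions on \<^typ>\<open>real\<close>; their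
  values at negative arguments are never constrained and never used.\<close>

definition indemnities :: "(real \<Rightarrow> real) set" where
  "indemnities = {f. f 0 = 0 \<and> (\<forall>x\<ge>0. 0 \<le> f x) \<and>
     (\<forall>x y. 0 \<le> x \<longrightarrow> x \<le> y \<longrightarrow> 0 \<le> f y - f x \<and> f y - f x \<le> y - x)}"

text \<open>The likelihood ratio may take the value \<open>\<infinity>\<close>, so \<open>Q\<close> need not be absolutely continuous
  with respect to \<open>P\<close>. Integration against \<open>dF\<close> is integration with respect to the law of \<open>Y\<close>
  under \<open>P\<close>.\<close>

definition likelihood_ratio ::
    "'a measure \<Rightarrow> 'a measure \<Rightarrow> ('a \<Rightarrow> real) \<Rightarrow> (real \<Rightarrow> ennreal) \<Rightarrow> bool" where
  "likelihood_ratio P Q Y LR \<longleftrightarrow> LR \<in> borel_measurable borel \<and>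
     (\<forall>E\<in>sets borel. emeasure Q {\<omega>\<in>space Q. Y \<omega> \<in> E \<and> LR (Y \<omega>) < \<infinity>}
        = (\<integral>\<^sup>+y. LR y * indicator E y \<partial>distr P borel Y))"

definition bounded_variation_on :: "real set \<Rightarrow> (real \<Rightarrow> real) \<Rightarrow> bool" where
  "bounded_variation_on A f \<longleftrightarrow>
     (\<exists>c. \<forall>N x. (\<forall>k\<le>N. x k \<in> A) \<and> mono_on {0..N} x \<longrightarrow>
        (\<Sum>k<N. \<bar>f (x (Suc k)) - f (x k)\<bar>) \<le> c)"

text \<open>Finite variation is understood locally, as for paths of processes: on every bounded interval.
  Only points where the likelihood ratio is finite enter, so isolated infinite values are
  not excluded by this condition.\<close>

definition finite_variation :: "(real \<Rightarrow> ennreal) \<Rightarrow> bool" where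
  "finite_variation LR \<longleftrightarrow>
     (\<forall>b. bounded_variation_on {x\<in>{0..b}. LR x < \<infinity>} (\<lambda>x. enn2real (LR x)))"

text \<open>Points with \<open>LR = \<infinity>\<close> have to be listed separately, since \<^term>\<open>enn2real\<close> sends \<open>\<infinity>\<close>
  to \<open>0\<close>. At the point \<open>0\<close> the derivatives are one-sided.\<close>

definition nondiff_points :: "(real \<Rightarrow> ennreal) \<Rightarrow> (real \<Rightarrow> real) \<Rightarrow> real set" where
  "nondiff_points LR F = {y. 0 \<le> y \<and>
     (LR y = \<infinity> \<or> \<not> (\<lambda>x. enn2real (LR x)) differentiable (at y within {0..})
        \<or> \<not> F differentiable (at y within {0..}))}"

text \<open>Where \<open>LR = \<infinity>\<close> the value of \<open>phi\<close> is a convention. It is never relevant: such points are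
  points of non-differentiability, hence left endpoints of pieces of the partition below, and there
  the clamped formulas involving \<open>phi\<close> do not depend on its value.\<close>

definition phi ::
    "real \<Rightarrow> real \<Rightarrow> real \<Rightarrow> real \<Rightarrow> (real \<Rightarrow> ennreal) \<Rightarrow> real \<Rightarrow> real \<Rightarrow> real \<Rightarrow> real" where
  "phi T r \<gamma> \<theta> LR lam t y =
     y + (lam - (1 + \<theta>) * enn2real (LR y)) / (\<gamma> * exp (r * (T - t)))"

text \<open>Pieces cut out by \<open>p 0 \<le> p 1 \<le> \<dots> \<le> p n\<close> with \<open>p (n+1) = \<infinity>\<close>; the index runs over
  \<open>{1..n+1}\<close>.\<close>

definition open_piece :: "(nat \<Rightarrow> real) \<Rightarrow> nat \<Rightarrow> nat \<Rightarrow> real set" where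
  "open_piece p n i = (if i \<le> n then {p (i - 1)<..<p i} else {p (i - 1)<..})"

definition piece :: "(nat \<Rightarrow> real) \<Rightarrow> nat \<Rightarrow> nat \<Rightarrow> real set" where
  "piece p n i = (if i \<le> n then {p (i - 1)..<p i} else {p (i - 1)..})"

definition slope_range :: "nat \<Rightarrow> real set" where
  "slope_range j =
     (if j = 1 then {1<..} else if j = 2 then {0..1} else if j = 3 then {..<0} else {})"

text \<open>\<open>D i\<close> is a division of the \<open>i\<close>-th open piece of \<open>p\<close> into finitely many disjoint sub-intervals
  (of any kind, degenerate ones included), on each of which the slope \<open>g\<close> is of one type.\<close>

definition slope_subdivision ::
    "(real \<Rightarrow> real) \<Rightarrow> (nat \<Rightarrow> real) \<Rightarrow> nat \<Rightarrow> (nat \<Rightarrow> real set set) \<Rightarrow> bool" where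
  "slope_subdivision g p n D \<longleftrightarrow>
     (\<forall>i\<in>{1..n+1}. finite (D i) \<and> partition_on (open_piece p n i) (D i) \<and>
        (\<forall>K\<in>D i. is_interval K \<and> (\<exists>!j. \<forall>y\<in>K. g y \<in> slope_range j)))"

text \<open>The frontier of a nonempty proper interval of the real line is the set of its finite
  endpoints.\<close>

definition typed_partition ::
    "(real \<Rightarrow> real) \<Rightarrow> nat \<Rightarrow> (nat \<Rightarrow> real set set) \<Rightarrow> nat \<Rightarrow> (nat \<Rightarrow> real) \<Rightarrow> (nat \<Rightarrow> nat) \<Rightarrow> bool" where
  "typed_partition g n D m y j \<longleftrightarrow>
     y 0 = 0 \<and> strict_mono_on {0..m} y \<and>
     y ` {0..m} = insert 0 (\<Union>i\<in>{1..n+1}. \<Union>K\<in>D i. frontier K) \<and>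
     (\<forall>i\<in>{1..m+1}. \<forall>x\<in>open_piece y m i. g x \<in> slope_range (j i))"

definition objective ::
    "real \<Rightarrow> real \<Rightarrow> real \<Rightarrow> real \<Rightarrow> 'a measure \<Rightarrow> 'a measure \<Rightarrow> ('a \<Rightarrow> real) \<Rightarrow> real \<Rightarrow> real
      \<Rightarrow> (real \<Rightarrow> real) \<Rightarrow> real" where
  "objective T r \<gamma> \<theta> P Q Y lam t I =
     (1 + \<theta>) * (\<integral>\<omega>. I (Y \<omega>) \<partial>Q)
     + \<gamma> * exp (r * (T - t)) / 2 * (\<integral>\<omega>. (I (Y \<omega>))\<^sup>2 \<partial>P)
     - \<gamma> * exp (r * (T - t)) * (\<integral>\<omega>. Y \<omega> * I (Y \<omega>) \<partial>P)
     - lam * (\<integral>\<omega>. I (Y \<omega>) \<partial>P)"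

definition optimal_indemnity ::
    "real \<Rightarrow> real \<Rightarrow> real \<Rightarrow> real \<Rightarrow> 'a measure \<Rightarrow> 'a measure \<Rightarrow> ('a \<Rightarrow> real) \<Rightarrow> real \<Rightarrow> real
      \<Rightarrow> (real \<Rightarrow> real) \<Rightarrow> bool" where
  "optimal_indemnity T r \<gamma> \<theta> P Q Y lam t I \<longleftrightarrow>
     is_arg_min (objective T r \<gamma> \<theta> P Q Y lam t) (\<lambda>f. f \<in> indemnities) I"

definition layer :: "real \<Rightarrow> real \<Rightarrow> real \<Rightarrow> real" where
  "layer a b x = max (x - a) 0 - max (x - b) 0"

end

theory Submission
  imports Defs
begin

text \<open>
  Write \<open>c = \<gamma> e\<^bsup>r (T - t)\<^esup>\<close>. Replacing \<open>dQ\<close> by \<open>LR dF\<close>, the objective formally becomes, up to a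
  constant and up to the contribution of the finitely many points where \<open>LR = \<infinity>\<close>, the weighted
  square distance \<open>c / 2 \<integral> (I - \<phi>)\<^sup>2 dF\<close>: the problem asks for the best approximation of \<open>\<phi>\<close> by
  an indemnity.

  A minimiser exists because the objective is strongly convex: along a minimising sequence the
  mean square distances tend to zero (\<open>sq_dist_le_excess\<close>). All indemnities are 1-Lipschitz and
  \<open>F\<close> charges every interval, so mean square closeness forces closeness at every single point
  (\<open>sq_dist_ge_pointwise\<close>). The sequence therefore converges pointwise, the limit is an
  indemnity, and dominated convergence gives its optimality (\<open>optimal_exists\<close>).

  The shape of a minimiser \<open>I\<close> comes from the first-order condition
  \<open>\<integral> (I - \<phi>) (g - I) dF \<ge> 0\<close> for every indemnity \<open>g\<close> that agrees with \<open>I\<close> where \<open>LR = \<infinity>\<close>.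
  If \<open>g\<close> differs from \<open>I\<close> only on one open piece and \<open>(I - \<phi>) (g - I) \<le> 0\<close> there, then by
  continuity and full support \<open>(I - \<phi>) (g - I)\<close> vanishes on the piece
  (\<open>optimal_unimprovable\<close>). It remains to find, for each type of piece, a competitor \<open>g\<close> of the
  asserted form which lies everywhere on the same side of \<open>I\<close> as \<open>\<phi>\<close>.

  If the slope of \<open>\<phi>\<close> lies in \<open>[0, 1]\<close>, then \<open>\<phi>\<close> clamped between the least and the greatest
  indemnity with the given values at the endpoints is itself admissible, and is the competitor.
  If the slope exceeds \<open>1\<close>, then \<open>I - \<phi>\<close> is strictly decreasing and changes sign at one point
  \<open>p\<close>; the competitor through \<open>(p, I p)\<close> is as small as possible before \<open>p\<close> and as large as
  possible after it, hence flat, then of slope \<open>1\<close>, then flat. If the slope is negative, the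
  signs are reversed, and the competitor has slope \<open>1\<close>, then \<open>0\<close>, then \<open>1\<close>. On the unbounded
  piece the sign change cannot escape to infinity, since there \<open>\<phi>\<close> outgrows every constant
  (slope above \<open>1\<close>) or is outgrown by every function of slope \<open>1\<close> (negative slope).
\<close>

section \<open>Indemnity functions and modifications on one piece\<close>

lemma indemnity_increment:
  assumes "I \<in> indemnities" "0 \<le> x" "x \<le> y"
  shows "I x \<le> I y" "I y - I x \<le> y - x"
  using assms unfolding indemnities_def by auto

lemma indemnity_bounds:
  assumes "I \<in> indemnities" "0 \<le> x"
  shows "0 \<le> I x" "I x \<le> x"
  using assms unfolding indemnities_def by force+

lemma indemnity_lipschitz:
  assumes "I \<in> indemnities" "0 \<le> x" "0 \<le> y"
  shows "\<bar>I x - I y\<bar> \<le> \<bar>x - y\<bar>"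
  using indemnity_increment[OF assms(1), of x y] indemnity_increment[OF assms(1), of y x] assms(2,3)
  by linarith

lemma indemnity_continuous:
  assumes "I \<in> indemnities"
  shows "continuous_on {0..} I"
  by (rule continuous_onI) (use indemnity_lipschitz[OF assms] in \<open>force simp: dist_real_def\<close>)

text \<open>Indemnities are arbitrary on the negative half-line, where they may fail to be measurable.\<close>

lemma indemnity_extension_measurable:
  assumes "I \<in> indemnities"
  shows "(\<lambda>x. I (max x 0)) \<in> borel_measurable borel"
  by (rule borel_measurable_mono)
    (use indemnity_increment(1)[OF assms] in \<open>auto simp: mono_def\<close>)

lemma indemnity_convex:
  assumes "f \<in> indemnities" "g \<in> indemnities" "0 \<le> e" "e \<le> 1"
  shows "(\<lambda>x. f x + e * (g x - f x)) \<in> indemnities"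
proof -
  have "0 \<le> (1 - e) * (f y - f x) + e * (g y - g x)"
    "(1 - e) * (f y - f x) + e * (g y - g x) \<le> y - x" if "0 \<le> x" "x \<le> y" for x y
  proof -
    note f = indemnity_increment[OF assms(1) that] and g = indemnity_increment[OF assms(2) that]
    show "0 \<le> (1 - e) * (f y - f x) + e * (g y - g x)" using f g assms(3,4) by simp
    show "(1 - e) * (f y - f x) + e * (g y - g x) \<le> y - x"
      by (rule convex_bound_le) (use f g assms(3,4) in auto)
  qed
  then have incr: "0 \<le> (f y + e * (g y - f y)) - (f x + e * (g x - f x))"
    "(f y + e * (g y - f y)) - (f x + e * (g x - f x)) \<le> y - x" if "0 \<le> x" "x \<le> y" for x y
    using that by (simp_all add: algebra_simps)
  have "f 0 + e * (g 0 - f 0) = 0" using assms(1,2) by (simp add: indemnities_def)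
  then show ?thesis using incr incr(1)[of 0] by (simp add: indemnities_def)
qed

definition splice :: "real set \<Rightarrow> (real \<Rightarrow> real) \<Rightarrow> (real \<Rightarrow> real) \<Rightarrow> real \<Rightarrow> real" where
  "splice S h I x = (if x \<in> S then h x else I x)"

text \<open>The bounds confine \<open>h\<close> to the parallelogram of values that increments in \<open>[0, y - x]\<close> allow
  between \<open>(a, I a)\<close> and \<open>(b, I b)\<close>. This is what makes increments across \<open>a\<close> or \<open>b\<close> admissible.\<close>

lemma splice_bounded_indemnity:
  assumes I: "I \<in> indemnities" and ab: "0 \<le> a" "a < b"
    and bounds: "\<And>x. x \<in> {a<..<b} \<Longrightarrow>
      I a \<le> h x \<and> h x \<le> I b \<and> h x \<le> I a + x - a \<and> I b + x - b \<le> h x"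
    and incr: "\<And>x y. x \<in> {a<..<b} \<Longrightarrow> y \<in> {a<..<b} \<Longrightarrow> x < y \<Longrightarrow>
      h x \<le> h y \<and> h y - h x \<le> y - x"
  shows "splice {a<..<b} h I \<in> indemnities"
proof -
  let ?g = "splice {a<..<b} h I"
  have "?g x \<le> ?g y \<and> ?g y - ?g x \<le> y - x" if xy: "0 \<le> x" "x < y" for x y
  proof -
    consider "x \<in> {a<..<b}" "y \<in> {a<..<b}" | "x \<in> {a<..<b}" "b \<le> y" | "x \<le> a" "y \<in> {a<..<b}"
      | "x \<notin> {a<..<b}" "y \<notin> {a<..<b}"
      using xy by force
    then show ?thesis
    proof cases
      case 1
      then show ?thesis using incr xy by (simp add: splice_def)
    next
      case 2
      then show ?thesis
        using bounds[of x] indemnity_increment[OF I, of b y] ab by (simp add: splice_def)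
    next
      case 3
      then show ?thesis
        using bounds[of y] indemnity_increment[OF I, of x a] xy by (simp add: splice_def)
    next
      case 4
      then show ?thesis
        using indemnity_increment[OF I, of x y] xy unfolding splice_def by auto
    qed
  qed
  then have incr': "?g x \<le> ?g y \<and> ?g y - ?g x \<le> y - x" if "0 \<le> x" "x \<le> y" for x y
    using that by (cases "x = y") auto
  have g0: "?g 0 = 0" using I ab by (simp add: splice_def indemnities_def)
  then have "0 \<le> ?g x" if "0 \<le> x" for x using incr'[of 0 x] that by simp
  then show ?thesis using incr' g0 by (simp add: indemnities_def)
qed

lemma splice_unbounded_indemnity:
  assumes I: "I \<in> indemnities" and a: "0 \<le> a"
    and bounds: "\<And>x. x \<in> {a<..} \<Longrightarrow> I a \<le> h x \<and> h x \<le> I a + x - a"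
    and incr: "\<And>x y. x \<in> {a<..} \<Longrightarrow> y \<in> {a<..} \<Longrightarrow> x < y \<Longrightarrow>
      h x \<le> h y \<and> h y - h x \<le> y - x"
  shows "splice {a<..} h I \<in> indemnities"
proof -
  let ?g = "splice {a<..} h I"
  have "?g x \<le> ?g y \<and> ?g y - ?g x \<le> y - x" if xy: "0 \<le> x" "x < y" for x y
  proof -
    consider "x \<in> {a<..}" "y \<in> {a<..}" | "x \<le> a" "y \<in> {a<..}"
      | "x \<notin> {a<..}" "y \<notin> {a<..}"
      using xy by force
    then show ?thesis
    proof cases
      case 1
      then show ?thesis using incr xy by (simp add: splice_def)
    next
      case 2
      then show ?thesis
        using bounds[of y] indemnity_increment[OF I, of x a] xy by (simp add: splice_def)
    next
      case 3
      then show ?thesis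
        using indemnity_increment[OF I, of x y] xy unfolding splice_def by auto
    qed
  qed
  then have incr': "?g x \<le> ?g y \<and> ?g y - ?g x \<le> y - x" if "0 \<le> x" "x \<le> y" for x y
    using that by (cases "x = y") auto
  have g0: "?g 0 = 0" using I a by (simp add: splice_def indemnities_def)
  then have "0 \<le> ?g x" if "0 \<le> x" for x using incr'[of 0 x] that by simp
  then show ?thesis using incr' g0 by (simp add: indemnities_def)
qed

section \<open>The shape of an unimprovable indemnity on one piece\<close>

text \<open>The form in which optimality enters the analysis of a single piece. When \<open>I\<close> is moved towards
  \<open>\<phi>\<close>, so that \<open>(I - \<phi>) (h - I) \<le> 0\<close>, the square distance to \<open>\<phi>\<close> decreases to first order; so
  for an optimal \<open>I\<close> this product must vanish.\<close>

definition unimprovable_on :: "real set \<Rightarrow> (real \<Rightarrow> real) \<Rightarrow> (real \<Rightarrow> real) \<Rightarrow> bool" where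
  "unimprovable_on S \<phi> I \<longleftrightarrow>
     (\<forall>h. splice S h I \<in> indemnities \<longrightarrow> (\<forall>x\<in>S. (I x - \<phi> x) * (h x - I x) \<le> 0) \<longrightarrow>
       (\<forall>x\<in>S. (I x - \<phi> x) * (h x - I x) = 0))"

lemma unimprovable_onD:
  assumes "unimprovable_on S \<phi> I" "splice S h I \<in> indemnities"
    "\<And>x. x \<in> S \<Longrightarrow> (I x - \<phi> x) * (h x - I x) \<le> 0" "x \<in> S"
  shows "I x = \<phi> x \<or> h x = I x"
  using assms unfolding unimprovable_on_def by fastforce

text \<open>The point may coincide with the left end \<open>a\<close> or with the bound \<open>c\<close>. This covers functions
  without zeros, and one statement serves bounded and unbounded pieces.\<close>

lemma sign_change_point:
  fixes k :: "real \<Rightarrow> real"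
  assumes S: "\<And>x. x \<in> S \<Longrightarrow> a < x \<and> {a<..x} \<subseteq> S"
    and decr: "\<And>x y. x \<in> S \<Longrightarrow> y \<in> S \<Longrightarrow> x < y \<Longrightarrow> k y < k x"
    and c: "a \<le> c" "\<And>x. x \<in> S \<Longrightarrow> k x > 0 \<Longrightarrow> x \<le> c"
  obtains p where "a \<le> p" "p \<le> c"
    "\<And>x. x \<in> S \<Longrightarrow> x < p \<Longrightarrow> k x > 0" "\<And>x. x \<in> S \<Longrightarrow> p < x \<Longrightarrow> k x < 0"
proof
  define A where "A = insert a {x\<in>S. k x > 0}"
  \<comment> \<open>Inserting \<open>a\<close> keeps the supremum meaningful when \<open>k\<close> is nowhere positive.\<close>
  define p where "p = Sup A"
  have bdd: "bdd_above A" using c unfolding A_def bdd_above_def by auto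
  have "A \<noteq> {}" by (simp add: A_def)
  show ap: "a \<le> p" unfolding p_def by (rule cSup_upper[OF _ bdd]) (simp add: A_def)
  show "p \<le> c" unfolding p_def
    by (rule cSup_least) (use c in \<open>auto simp: A_def\<close>)
  show "k x > 0" if x: "x \<in> S" "x < p" for x
  proof -
    obtain y where "y \<in> A" "x < y"
      using x(2) less_cSup_iff[OF \<open>A \<noteq> {}\<close> bdd] unfolding p_def by auto
    then show ?thesis
      using S[OF x(1)] decr[OF x(1), of y] unfolding A_def by auto
  qed
  show "k x < 0" if x: "x \<in> S" "p < x" for x
  proof -
    define z where "z = (p + x) / 2"
    have z: "p < z" "z < x" using x by (auto simp: z_def)
    then have zS: "z \<in> S" using S[OF x(1)] ap by auto
    have "z \<notin> A" using z cSup_upper[OF _ bdd, of z] unfolding p_def by auto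
    then have "k z \<le> 0" using zS unfolding A_def by auto
    then show ?thesis using decr[OF zS x(1) z(2)] by simp
  qed
qed


text \<open>Where \<open>I \<noteq> \<phi>\<close>, a vanishing product forces \<open>h = I\<close>. In the applications \<open>p\<close> is the point at
  which \<open>I - \<phi>\<close> changes sign, the only one where \<open>I = \<phi>\<close> is possible.\<close>

lemma unimprovable_eq_competitor:
  assumes opt: "unimprovable_on S \<phi> I" and comp: "splice S h I \<in> indemnities"
    and off: "\<And>x. x \<in> S \<Longrightarrow> x \<noteq> p \<Longrightarrow> I x \<noteq> \<phi> x \<and> (I x - \<phi> x) * (h x - I x) \<le> 0"
    and at: "p \<in> S \<Longrightarrow> h p = I p" and x: "x \<in> S"
  shows "h x = I x"
proof -
  have "(I u - \<phi> u) * (h u - I u) \<le> 0" if "u \<in> S" for u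
    using off[OF that] at that by (cases "u = p") auto
  then have "I x = \<phi> x \<or> h x = I x" by (rule unimprovable_onD[OF opt comp _ x])
  then show ?thesis using off[OF x] at x by (cases "x = p") auto
qed

text \<open>Here \<open>I\<close> lies above \<open>\<phi>\<close> before \<open>p\<close> and below it afterwards. Among the indemnities through
  \<open>(a, I a)\<close>, \<open>(p, I p)\<close> and \<open>(b, I b)\<close> the competitor is the least one before \<open>p\<close> and the
  greatest one after \<open>p\<close>: it stays at \<open>I a\<close>, rises with slope \<open>1\<close> through \<open>(p, I p)\<close> and stays
  at \<open>I b\<close>.\<close>

lemma bounded_piece_steep:
  assumes I: "I \<in> indemnities" and ab: "0 \<le> a" "a < b"
    and opt: "unimprovable_on {a<..<b} \<phi> I"
    and slope: "\<And>x y. x \<in> {a<..<b} \<Longrightarrow> y \<in> {a<..<b} \<Longrightarrow> x < y \<Longrightarrow> y - x < \<phi> y - \<phi> x"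
  shows "\<exists>s\<in>{a..b}. \<forall>x\<in>{a..<b}. I x = I a + layer s (s + I b - I a) x"
proof -
  obtain p where p: "a \<le> p" "p \<le> b"
    "\<And>x. x \<in> {a<..<b} \<Longrightarrow> x < p \<Longrightarrow> I x - \<phi> x > 0"
    "\<And>x. x \<in> {a<..<b} \<Longrightarrow> p < x \<Longrightarrow> I x - \<phi> x < 0"
  proof (rule sign_change_point[of "{a<..<b}" a "\<lambda>x. I x - \<phi> x" b])
    show "I y - \<phi> y < I x - \<phi> x" if "x \<in> {a<..<b}" "y \<in> {a<..<b}" "x < y" for x y
      using slope[OF that] indemnity_increment[OF I, of x y] that ab by auto
  qed (use ab in auto)
  have incr: "I a \<le> I p" "I p - I a \<le> p - a" "I p \<le> I b" "I b - I p \<le> b - p"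
    using indemnity_increment[OF I, of a p] indemnity_increment[OF I, of p b] ab p by auto
  define h where "h x = min (I b) (max (I a) (I p + x - p))" for x
  have eq: "h x = I x" if x: "x \<in> {a<..<b}" for x
  proof (rule unimprovable_eq_competitor[OF opt _ _ _ x])
    show "splice {a<..<b} h I \<in> indemnities"
      by (rule splice_bounded_indemnity[OF I ab]) (use incr in \<open>auto simp: h_def\<close>)
    show "h p = I p" using incr by (simp add: h_def)
    fix u assume u: "u \<in> {a<..<b}" "u \<noteq> p"
    have Iu: "I a \<le> I u" "I u \<le> I b"
      using indemnity_increment[OF I, of a u] indemnity_increment[OF I, of u b] u ab by auto
    show "I u \<noteq> \<phi> u \<and> (I u - \<phi> u) * (h u - I u) \<le> 0"
    proof (cases "u < p")
      case True
      then have "h u \<le> I u"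
        using indemnity_increment[OF I, of u p] Iu u ab unfolding h_def by auto
      then show ?thesis using p(3)[OF u(1) True] by (simp add: mult_nonneg_nonpos)
    next
      case False
      then have "I u \<le> h u"
        using indemnity_increment[OF I, of p u] Iu p(1) ab unfolding h_def by auto
      then show ?thesis using p(4)[OF u(1)] False u(2) by (simp add: mult_nonpos_nonneg)
    qed
  qed
  define s where "s = p - (I p - I a)"
  have s: "s \<in> {a..b}" using incr p by (auto simp: s_def)
  show ?thesis
  proof (intro bexI[OF _ s] ballI)
    fix x assume x: "x \<in> {a..<b}"
    show "I x = I a + layer s (s + I b - I a) x"
    proof (cases "x = a")
      case True
      then show ?thesis using s incr by (auto simp: layer_def)
    next
      case False
      then have "I x = h x" using eq x by auto
      then show ?thesis using incr unfolding h_def layer_def s_def by auto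
    qed
  qed
qed

text \<open>The mirror image: \<open>I\<close> lies below \<open>\<phi>\<close> before \<open>p\<close> and above it afterwards, so the competitor is
  the greatest indemnity before \<open>p\<close> and the least one after \<open>p\<close>. It rises with slope \<open>1\<close>, stays
  at \<open>I p\<close>, and rises again.\<close>

lemma bounded_piece_decreasing:
  assumes I: "I \<in> indemnities" and ab: "0 \<le> a" "a < b"
    and opt: "unimprovable_on {a<..<b} \<phi> I"
    and slope: "\<And>x y. x \<in> {a<..<b} \<Longrightarrow> y \<in> {a<..<b} \<Longrightarrow> x < y \<Longrightarrow> \<phi> y < \<phi> x"
  shows "\<exists>s\<in>{a..b}. \<forall>x\<in>{a..<b}. I x = I a + x - a - layer s (s + b - a - I b + I a) x"
proof -
  obtain p where p: "a \<le> p" "p \<le> b"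
    "\<And>x. x \<in> {a<..<b} \<Longrightarrow> x < p \<Longrightarrow> \<phi> x - I x > 0"
    "\<And>x. x \<in> {a<..<b} \<Longrightarrow> p < x \<Longrightarrow> \<phi> x - I x < 0"
  proof (rule sign_change_point[of "{a<..<b}" a "\<lambda>x. \<phi> x - I x" b])
    show "\<phi> y - I y < \<phi> x - I x" if "x \<in> {a<..<b}" "y \<in> {a<..<b}" "x < y" for x y
      using slope[OF that] indemnity_increment[OF I, of x y] that ab by auto
  qed (use ab in auto)
  have incr: "I a \<le> I p" "I p - I a \<le> p - a" "I p \<le> I b" "I b - I p \<le> b - p"
    using indemnity_increment[OF I, of a p] indemnity_increment[OF I, of p b] ab p by auto
  define h where "h x = max (min (I a + x - a) (I p)) (I b + x - b)" for x
  have eq: "h x = I x" if x: "x \<in> {a<..<b}" for x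
  proof (rule unimprovable_eq_competitor[OF opt _ _ _ x])
    show "splice {a<..<b} h I \<in> indemnities"
      by (rule splice_bounded_indemnity[OF I ab]) (use incr in \<open>auto simp: h_def\<close>)
    show "h p = I p" using incr by (simp add: h_def)
    fix u assume u: "u \<in> {a<..<b}" "u \<noteq> p"
    have Iu: "I u - I a \<le> u - a" "I b - I u \<le> b - u"
      using indemnity_increment[OF I, of a u] indemnity_increment[OF I, of u b] u ab by auto
    show "I u \<noteq> \<phi> u \<and> (I u - \<phi> u) * (h u - I u) \<le> 0"
    proof (cases "u < p")
      case True
      then have "I u \<le> h u"
        using indemnity_increment[OF I, of u p] Iu u ab unfolding h_def by auto
      then show ?thesis using p(3)[OF u(1) True] by (simp add: mult_nonpos_nonneg)
    next
      case False
      then have "h u \<le> I u"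
        using indemnity_increment[OF I, of p u] Iu p(1) ab unfolding h_def by auto
      then show ?thesis using p(4)[OF u(1)] False u(2) by (simp add: mult_nonneg_nonpos)
    qed
  qed
  define s where "s = a + (I p - I a)"
  have s: "s \<in> {a..b}" using incr p by (auto simp: s_def)
  show ?thesis
  proof (intro bexI[OF _ s] ballI)
    fix x assume x: "x \<in> {a..<b}"
    show "I x = I a + x - a - layer s (s + b - a - I b + I a) x"
    proof (cases "x = a")
      case True
      then show ?thesis using s incr p by (auto simp: layer_def)
    next
      case False
      then have "I x = h x" using eq x by auto
      then show ?thesis using incr p unfolding h_def layer_def s_def by auto
    qed
  qed
qed

lemma clamp_increment:
  fixes v v' l l' u u' d :: real
  assumes "v \<le> v' \<and> v' - v \<le> d" "l \<le> l' \<and> l' - l \<le> d" "u \<le> u' \<and> u' - u \<le> d"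
  shows "min (max v l) u \<le> min (max v' l') u' \<and>
    min (max v' l') u' - min (max v l) u \<le> d"
proof -
  have "max v l \<le> max v' l' \<and> max v' l' - max v l \<le> d" using assms(1,2) by linarith
  then show ?thesis using assms(3) by linarith
qed

text \<open>The value of \<open>[l x, u x]\<close> nearest to \<open>\<phi> x\<close> lies between \<open>\<phi> x\<close> and \<open>I x\<close> whenever \<open>\<phi> x\<close> is
  outside that interval, and equals \<open>\<phi> x\<close> otherwise. In both cases the product vanishes only if
  \<open>I x\<close> is this nearest value.\<close>

lemma clamp_eq_of_unimprovable:
  assumes opt: "unimprovable_on S \<phi> I"
    and comp: "splice S (\<lambda>x. min (max (\<phi> x) (l x)) (u x)) I \<in> indemnities"
    and between: "\<And>x. x \<in> S \<Longrightarrow> l x \<le> I x \<and> I x \<le> u x" and x: "x \<in> S"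
  shows "I x = min (max (\<phi> x) (l x)) (u x)"
proof -
  let ?h = "\<lambda>x. min (max (\<phi> x) (l x)) (u x)"
  have "(I z - \<phi> z) * (?h z - I z) \<le> 0" if "z \<in> S" for z
    using between[OF that] by (auto simp: mult_le_0_iff)
  then have "I x = \<phi> x \<or> ?h x = I x" by (rule unimprovable_onD[OF opt comp _ x])
  then show ?thesis using between[OF x] by auto
qed

text \<open>Clamping \<open>\<phi>\<close> between the least and the greatest indemnity with values \<open>I a\<close> and \<open>I b\<close> at the
  ends keeps its slopes in \<open>[0, 1]\<close>, so the pointwise nearest value is an admissible competitor.
  At \<open>a\<close> both bounds equal \<open>I a\<close>, so that the formula does not depend on \<open>\<phi> a\<close>.\<close>

lemma bounded_piece_moderate:
  assumes I: "I \<in> indemnities" and ab: "0 \<le> a" "a < b"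
    and opt: "unimprovable_on {a<..<b} \<phi> I"
    and slope: "\<And>x y. x \<in> {a<..<b} \<Longrightarrow> y \<in> {a<..<b} \<Longrightarrow> x < y \<Longrightarrow>
      \<phi> x \<le> \<phi> y \<and> \<phi> y - \<phi> x \<le> y - x"
  shows "\<forall>x\<in>{a..<b}. I x = min (min (max (max (\<phi> x) (I b + x - b)) (I a)) (I a + x - a)) (I b)"
proof
  fix x assume x: "x \<in> {a..<b}"
  have Iab: "I a \<le> I b" "I b - I a \<le> b - a"
    using indemnity_increment[OF I, of a b] ab by auto
  show "I x = min (min (max (max (\<phi> x) (I b + x - b)) (I a)) (I a + x - a)) (I b)"
  proof (cases "x = a")
    case True
    then show ?thesis using Iab by auto
  next
    case False
    let ?l = "\<lambda>x. max (I b + x - b) (I a)" and ?u = "\<lambda>x. min (I a + x - a) (I b)"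
    have "I x = min (max (\<phi> x) (?l x)) (?u x)"
    proof (rule clamp_eq_of_unimprovable[OF opt])
      show "splice {a<..<b} (\<lambda>x. min (max (\<phi> x) (?l x)) (?u x)) I \<in> indemnities"
      proof (rule splice_bounded_indemnity[OF I ab])
        fix v w assume vw: "v \<in> {a<..<b}" "w \<in> {a<..<b}" "v < w"
        show "min (max (\<phi> v) (?l v)) (?u v) \<le> min (max (\<phi> w) (?l w)) (?u w) \<and>
            min (max (\<phi> w) (?l w)) (?u w) - min (max (\<phi> v) (?l v)) (?u v) \<le> w - v"
          by (rule clamp_increment[OF slope[OF vw]]) (use vw in auto)
      qed (use Iab in auto)
      show "?l v \<le> I v \<and> I v \<le> ?u v" if "v \<in> {a<..<b}" for v
        using indemnity_increment[OF I, of a v] indemnity_increment[OF I, of v b] that ab by auto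
    qed (use x False in auto)
    then show ?thesis by (simp add: max.assoc min.assoc)
  qed
qed

text \<open>As on a bounded piece, but without an upper plateau. The sign change has to be shown to occur:
  if \<open>I\<close> stayed above \<open>\<phi>\<close>, it would be constant, while \<open>\<phi>\<close> grows at least linearly.\<close>

lemma unbounded_piece_steep:
  assumes I: "I \<in> indemnities" and a: "0 \<le> a"
    and opt: "unimprovable_on {a<..} \<phi> I"
    and slope: "\<And>x y. x \<in> {a<..} \<Longrightarrow> y \<in> {a<..} \<Longrightarrow> x < y \<Longrightarrow> y - x < \<phi> y - \<phi> x"
  shows "\<exists>s\<ge>a. \<forall>x\<in>{a..}. I x = I a + max (x - s) 0"
proof -
  have decr: "I y - \<phi> y < I x - \<phi> x" if "x \<in> {a<..}" "y \<in> {a<..}" "x < y" for x y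
    using slope[OF that] indemnity_increment[OF I, of x y] that a by auto
  have Ia: "I a \<le> I x \<and> I x - I a \<le> x - a" if "a \<le> x" for x
    using indemnity_increment[OF I, of a x] that a by auto
  have "\<exists>c>a. I c \<le> \<phi> c"
  proof (rule ccontr)
    assume "\<not> ?thesis"
    then have above: "\<phi> x < I x" if "a < x" for x using that by force
    have const: "I a = I x" if "a < x" for x
    proof -
      have "I x = \<phi> x \<or> I a = I x"
      proof (rule unimprovable_onD[OF opt])
        show "splice {a<..} (\<lambda>x. I a) I \<in> indemnities"
          by (rule splice_unbounded_indemnity[OF I a]) auto
        show "(I x - \<phi> x) * (I a - I x) \<le> 0" if "x \<in> {a<..}" for x
          using above[of x] Ia[of x] that by (auto simp: mult_le_0_iff)
      qed (use that in auto)
      then show ?thesis using above[OF that] by simp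
    qed
    \<comment> \<open>From \<open>a + 1\<close> on, \<open>\<phi>\<close> grows faster than the identity, so at \<open>z\<close> it exceeds \<open>I a\<close>.\<close>
    define z where "z = a + 1 + max 1 (I a - \<phi> (a + 1))"
    have "z - (a + 1) < \<phi> z - \<phi> (a + 1)" by (rule slope) (auto simp: z_def)
    moreover have "a < z" by (simp add: z_def)
    then have "\<phi> z < I a" using above const by metis
    ultimately show False unfolding z_def by linarith
  qed
  then obtain c where c: "a < c" "I c \<le> \<phi> c" by blast
  obtain p where p: "a \<le> p" "p \<le> c"
    "\<And>x. x \<in> {a<..} \<Longrightarrow> x < p \<Longrightarrow> I x - \<phi> x > 0"
    "\<And>x. x \<in> {a<..} \<Longrightarrow> p < x \<Longrightarrow> I x - \<phi> x < 0"
  proof (rule sign_change_point[of "{a<..}" a "\<lambda>x. I x - \<phi> x" c])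
    show "x \<le> c" if "x \<in> {a<..}" "I x - \<phi> x > 0" for x
      using decr[of c x] c that by force
  qed (use decr c in auto)
  note Iap = Ia[OF p(1)]
  define h where "h x = max (I a) (I p + x - p)" for x
  have eq: "h x = I x" if x: "x \<in> {a<..}" for x
  proof (rule unimprovable_eq_competitor[OF opt _ _ _ x])
    show "splice {a<..} h I \<in> indemnities"
      by (rule splice_unbounded_indemnity[OF I a]) (use Iap in \<open>auto simp: h_def\<close>)
    show "h p = I p" using Iap by (simp add: h_def)
    fix u assume u: "u \<in> {a<..}" "u \<noteq> p"
    show "I u \<noteq> \<phi> u \<and> (I u - \<phi> u) * (h u - I u) \<le> 0"
    proof (cases "u < p")
      case True
      then have "h u \<le> I u"
        using indemnity_increment[OF I, of u p] Ia[of u] u a unfolding h_def by auto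
      then show ?thesis using p(3)[OF u(1) True] by (simp add: mult_nonneg_nonpos)
    next
      case False
      then have "I u \<le> h u"
        using indemnity_increment[OF I, of p u] p(1) a unfolding h_def by auto
      then show ?thesis using p(4)[OF u(1)] False u(2) by (simp add: mult_nonpos_nonneg)
    qed
  qed
  define s where "s = p - (I p - I a)"
  have s: "a \<le> s" using Iap p by (auto simp: s_def)
  show ?thesis
  proof (intro exI[of _ s] conjI s ballI)
    fix x assume x: "x \<in> {a..}"
    show "I x = I a + max (x - s) 0"
    proof (cases "x = a")
      case True
      then show ?thesis using s by auto
    next
      case False
      then have "I x = h x" using eq x by auto
      then show ?thesis unfolding h_def s_def by auto
    qed
  qed
qed

text \<open>If \<open>I\<close> stayed below \<open>\<phi>\<close>, it would have slope \<open>1\<close> throughout and overtake the decreasing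
  \<open>\<phi>\<close>. So the sign change occurs, and after it \<open>I\<close> is constant.\<close>

lemma unbounded_piece_decreasing:
  assumes I: "I \<in> indemnities" and a: "0 \<le> a"
    and opt: "unimprovable_on {a<..} \<phi> I"
    and slope: "\<And>x y. x \<in> {a<..} \<Longrightarrow> y \<in> {a<..} \<Longrightarrow> x < y \<Longrightarrow> \<phi> y < \<phi> x"
  shows "\<exists>s\<ge>a. \<forall>x\<in>{a..}. I x = I a + layer a s x"
proof -
  have decr: "\<phi> y - I y < \<phi> x - I x" if "x \<in> {a<..}" "y \<in> {a<..}" "x < y" for x y
    using slope[OF that] indemnity_increment[OF I, of x y] that a by auto
  have Ia: "I a \<le> I x \<and> I x - I a \<le> x - a" if "a \<le> x" for x
    using indemnity_increment[OF I, of a x] that a by auto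
  have "\<exists>c>a. \<phi> c \<le> I c"
  proof (rule ccontr)
    assume "\<not> ?thesis"
    then have below: "I x < \<phi> x" if "a < x" for x using that by force
    have full: "I a + x - a = I x" if "a < x" for x
    proof -
      have "I x = \<phi> x \<or> I a + x - a = I x"
      proof (rule unimprovable_onD[OF opt])
        show "splice {a<..} (\<lambda>x. I a + x - a) I \<in> indemnities"
          by (rule splice_unbounded_indemnity[OF I a]) auto
        show "(I x - \<phi> x) * (I a + x - a - I x) \<le> 0" if "x \<in> {a<..}" for x
          using below[of x] Ia[of x] that by (auto simp: mult_le_0_iff)
      qed (use that in auto)
      then show ?thesis using below[OF that] by simp
    qed
    \<comment> \<open>Far enough to the right for \<open>I a + z - a\<close> to exceed the upper bound \<open>\<phi> (a + 1)\<close>.\<close>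
    define z where "z = a + 1 + max 1 (\<phi> (a + 1) - I a)"
    have "\<phi> z < \<phi> (a + 1)" by (rule slope) (auto simp: z_def)
    moreover have "a < z" by (simp add: z_def)
    then have "I a + z - a < \<phi> z" using below full by metis
    ultimately show False unfolding z_def by linarith
  qed
  then obtain c where c: "a < c" "\<phi> c \<le> I c" by blast
  obtain p where p: "a \<le> p" "p \<le> c"
    "\<And>x. x \<in> {a<..} \<Longrightarrow> x < p \<Longrightarrow> \<phi> x - I x > 0"
    "\<And>x. x \<in> {a<..} \<Longrightarrow> p < x \<Longrightarrow> \<phi> x - I x < 0"
  proof (rule sign_change_point[of "{a<..}" a "\<lambda>x. \<phi> x - I x" c])
    show "x \<le> c" if "x \<in> {a<..}" "\<phi> x - I x > 0" for x
      using decr[of c x] c that by force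
  qed (use decr c in auto)
  note Iap = Ia[OF p(1)]
  define h where "h x = min (I a + x - a) (I p)" for x
  have eq: "h x = I x" if x: "x \<in> {a<..}" for x
  proof (rule unimprovable_eq_competitor[OF opt _ _ _ x])
    show "splice {a<..} h I \<in> indemnities"
      by (rule splice_unbounded_indemnity[OF I a]) (use Iap in \<open>auto simp: h_def\<close>)
    show "h p = I p" using Iap by (simp add: h_def)
    fix u assume u: "u \<in> {a<..}" "u \<noteq> p"
    show "I u \<noteq> \<phi> u \<and> (I u - \<phi> u) * (h u - I u) \<le> 0"
    proof (cases "u < p")
      case True
      then have "I u \<le> h u"
        using indemnity_increment[OF I, of u p] Ia[of u] u a unfolding h_def by auto
      then show ?thesis using p(3)[OF u(1) True] by (simp add: mult_nonpos_nonneg)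
    next
      case False
      then have "h u \<le> I u"
        using indemnity_increment[OF I, of p u] p(1) a unfolding h_def by auto
      then show ?thesis using p(4)[OF u(1)] False u(2) by (simp add: mult_nonneg_nonpos)
    qed
  qed
  define s where "s = a + (I p - I a)"
  have s: "a \<le> s" using Iap p by (auto simp: s_def)
  show ?thesis
  proof (intro exI[of _ s] conjI s ballI)
    fix x assume x: "x \<in> {a..}"
    show "I x = I a + layer a s x"
    proof (cases "x = a")
      case True
      then show ?thesis using s by (auto simp: layer_def)
    next
      case False
      then have "I x = h x" using eq x by auto
      then show ?thesis using s x unfolding h_def s_def layer_def by auto
    qed
  qed
qed

lemma unbounded_piece_moderate:
  assumes I: "I \<in> indemnities" and a: "0 \<le> a"
    and opt: "unimprovable_on {a<..} \<phi> I"
    and slope: "\<And>x y. x \<in> {a<..} \<Longrightarrow> y \<in> {a<..} \<Longrightarrow> x < y \<Longrightarrow>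
      \<phi> x \<le> \<phi> y \<and> \<phi> y - \<phi> x \<le> y - x"
  shows "\<forall>x\<in>{a..}. I x = min (I a + x - a) (max (I a) (\<phi> x))"
proof
  fix x assume x: "x \<in> {a..}"
  show "I x = min (I a + x - a) (max (I a) (\<phi> x))"
  proof (cases "x = a")
    case True
    then show ?thesis by auto
  next
    case False
    let ?l = "\<lambda>x::real. I a" and ?u = "\<lambda>x. I a + x - a"
    have "I x = min (max (\<phi> x) (?l x)) (?u x)"
    proof (rule clamp_eq_of_unimprovable[OF opt])
      show "splice {a<..} (\<lambda>x. min (max (\<phi> x) (?l x)) (?u x)) I \<in> indemnities"
      proof (rule splice_unbounded_indemnity[OF I a])
        fix v w assume vw: "v \<in> {a<..}" "w \<in> {a<..}" "v < w"
        show "min (max (\<phi> v) (?l v)) (?u v) \<le> min (max (\<phi> w) (?l w)) (?u w) \<and>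
            min (max (\<phi> w) (?l w)) (?u w) - min (max (\<phi> v) (?l v)) (?u v) \<le> w - v"
          by (rule clamp_increment[OF slope[OF vw]]) (use vw in auto)
      qed auto
      show "?l v \<le> I v \<and> I v \<le> ?u v" if "v \<in> {a<..}" for v
        using indemnity_increment[OF I, of a v] that a by auto
    qed (use x False in auto)
    then show ?thesis by (simp add: max.commute min.commute)
  qed
qed

section \<open>The objective: convexity, existence of a minimiser, first-order condition\<close>

locale reinsurance_problem =
  P: prob_space P + Q: prob_space Q for P Q :: "'a measure" +
  fixes Y :: "'a \<Rightarrow> real" and LR :: "real \<Rightarrow> ennreal" and F :: "real \<Rightarrow> real"
    and T r \<gamma> \<theta> lam t :: real
  assumes gamma_pos: "0 < \<gamma>"
    and sets_Q: "sets Q = sets P"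
    and Y_measurable: "Y \<in> borel_measurable P"
    and Y_nonneg: "\<omega> \<in> space P \<Longrightarrow> 0 \<le> Y \<omega>"
    and Y_integrable: "integrable P Y" "integrable P (\<lambda>\<omega>. (Y \<omega>)\<^sup>2)" "integrable Q Y"
    and F_eq: "F = cdf (distr P borel Y)"
    and F_strict_mono: "strict_mono_on {0..} F"
    and LR: "likelihood_ratio P Q Y LR"
begin

abbreviation J :: "(real \<Rightarrow> real) \<Rightarrow> real" where
  "J \<equiv> objective T r \<gamma> \<theta> P Q Y lam t"

abbreviation \<phi> :: "real \<Rightarrow> real" where
  "\<phi> \<equiv> phi T r \<gamma> \<theta> LR lam t"

definition c :: real where "c = \<gamma> * exp (r * (T - t))"

lemma c_pos: "0 < c" using gamma_pos by (simp add: c_def)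

lemma J_eq: "J f = (1 + \<theta>) * (\<integral>\<omega>. f (Y \<omega>) \<partial>Q) + c / 2 * (\<integral>\<omega>. (f (Y \<omega>))\<^sup>2 \<partial>P)
    - c * (\<integral>\<omega>. Y \<omega> * f (Y \<omega>) \<partial>P) - lam * (\<integral>\<omega>. f (Y \<omega>) \<partial>P)"
  by (simp add: objective_def c_def)

lemma space_Q: "space Q = space P" using sets_eq_imp_space_eq[OF sets_Q] .

lemma Y_measurable_Q: "Y \<in> borel_measurable Q"
  using Y_measurable measurable_cong_sets[OF sets_Q] by blast

lemma cover_measurable:
  assumes "f \<in> indemnities"
  shows "(\<lambda>\<omega>. f (Y \<omega>)) \<in> borel_measurable P" "(\<lambda>\<omega>. f (Y \<omega>)) \<in> borel_measurable Q"
proof -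
  have "(\<lambda>\<omega>. f (max (Y \<omega>) 0)) \<in> borel_measurable P"
    using measurable_compose[OF Y_measurable indemnity_extension_measurable[OF assms]] .
  then show P: "(\<lambda>\<omega>. f (Y \<omega>)) \<in> borel_measurable P"
    by (rule subst[OF measurable_cong, rotated]) (use Y_nonneg in auto)
  then show "(\<lambda>\<omega>. f (Y \<omega>)) \<in> borel_measurable Q"
    using measurable_cong_sets[OF sets_Q] by blast
qed

lemma cover_bounds:
  assumes "f \<in> indemnities" "\<omega> \<in> space P"
  shows "0 \<le> f (Y \<omega>)" "f (Y \<omega>) \<le> Y \<omega>"
  using indemnity_bounds[OF assms(1) Y_nonneg[OF assms(2)]] .

lemma full_cover_indemnity: "(\<lambda>x. x) \<in> indemnities" by (simp add: indemnities_def)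

lemma cover_integrable:
  assumes "f \<in> indemnities"
  shows "integrable P (\<lambda>\<omega>. f (Y \<omega>))" "integrable Q (\<lambda>\<omega>. f (Y \<omega>))"
proof -
  have le: "norm (f (Y \<omega>)) \<le> norm (Y \<omega>)" if "\<omega> \<in> space P" for \<omega>
    using cover_bounds[OF assms that] by simp
  show "integrable P (\<lambda>\<omega>. f (Y \<omega>))"
    using Y_integrable(1) cover_measurable(1)[OF assms]
    by (rule Bochner_Integration.integrable_bound) (use le in auto)
  show "integrable Q (\<lambda>\<omega>. f (Y \<omega>))"
    using Y_integrable(3) cover_measurable(2)[OF assms]
    by (rule Bochner_Integration.integrable_bound) (use le in \<open>auto simp: space_Q\<close>)
qed

lemma cover_product_integrable:
  assumes "f \<in> indemnities" "g \<in> indemnities"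
  shows "integrable P (\<lambda>\<omega>. f (Y \<omega>) * g (Y \<omega>))"
proof (rule Bochner_Integration.integrable_bound[OF Y_integrable(2)])
  show "(\<lambda>\<omega>. f (Y \<omega>) * g (Y \<omega>)) \<in> borel_measurable P"
    using cover_measurable assms by (intro borel_measurable_times) auto
  show "AE \<omega> in P. norm (f (Y \<omega>) * g (Y \<omega>)) \<le> norm ((Y \<omega>)\<^sup>2)"
    using cover_bounds[OF assms(1)] cover_bounds[OF assms(2)] Y_nonneg
    by (intro AE_I2) (auto simp: power2_eq_square abs_mult intro!: mult_mono)
qed

lemmas cover_power2_integrable =
  cover_product_integrable[where f = f and g = f for f, folded power2_eq_square]

lemmas Y_cover_integrable = cover_product_integrable[OF full_cover_indemnity]

text \<open>The directional derivative of the objective at \<open>f\<close> in the direction \<open>g - f\<close>.\<close>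

definition gateaux :: "(real \<Rightarrow> real) \<Rightarrow> (real \<Rightarrow> real) \<Rightarrow> real" where
  "gateaux f g = (1 + \<theta>) * (\<integral>\<omega>. g (Y \<omega>) - f (Y \<omega>) \<partial>Q)
    + c * (\<integral>\<omega>. (f (Y \<omega>) - Y \<omega>) * (g (Y \<omega>) - f (Y \<omega>)) \<partial>P)
    - lam * (\<integral>\<omega>. g (Y \<omega>) - f (Y \<omega>) \<partial>P)"

definition sq_dist :: "(real \<Rightarrow> real) \<Rightarrow> (real \<Rightarrow> real) \<Rightarrow> real" where
  "sq_dist f g = (\<integral>\<omega>. (g (Y \<omega>) - f (Y \<omega>))\<^sup>2 \<partial>P)"

lemma sq_dist_integrable:
  assumes "f \<in> indemnities" "g \<in> indemnities"
  shows "integrable P (\<lambda>\<omega>. (g (Y \<omega>) - f (Y \<omega>))\<^sup>2)"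
  unfolding power2_diff using assms
  by (intro Bochner_Integration.integrable_add Bochner_Integration.integrable_diff
      cover_power2_integrable)
    (auto simp: mult.assoc intro!: cover_product_integrable)

text \<open>The objective is quadratic on segments. Convexity, the parallelogram estimate and the
  first-order condition are all read off from this expansion.\<close>

lemma objective_segment:
  assumes f: "f \<in> indemnities" and g: "g \<in> indemnities"
  shows "J (\<lambda>x. f x + e * (g x - f x)) = J f + e * gateaux f g + e\<^sup>2 * (c / 2 * sq_dist f g)"
proof -
  note [simp] = cover_integrable[OF f] cover_integrable[OF g] cover_power2_integrable[OF f]
    cover_power2_integrable[OF g] Y_cover_integrable[OF f] Y_cover_integrable[OF g]
    cover_product_integrable[OF f g] sq_dist_integrable[OF f g]
  have cross: "integrable P (\<lambda>\<omega>. f (Y \<omega>) * (g (Y \<omega>) - f (Y \<omega>)))"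
    "integrable P (\<lambda>\<omega>. Y \<omega> * (g (Y \<omega>) - f (Y \<omega>)))"
    unfolding right_diff_distrib
    by (intro Bochner_Integration.integrable_diff cover_product_integrable Y_cover_integrable f g)+
  note [simp] = cross
  have sq: "(f x + e * (g x - f x))\<^sup>2 =
      (f x)\<^sup>2 + (2 * e) * (f x * (g x - f x)) + e\<^sup>2 * (g x - f x)\<^sup>2" for x
    by (simp add: power2_eq_square algebra_simps)
  have Ysq: "y * (f x + e * (g x - f x)) = y * f x + e * (y * (g x - f x))" for x y :: real
    by (simp add: algebra_simps)
  have mix: "(\<integral>\<omega>. (f (Y \<omega>) - Y \<omega>) * (g (Y \<omega>) - f (Y \<omega>)) \<partial>P) =
     (\<integral>\<omega>. f (Y \<omega>) * (g (Y \<omega>) - f (Y \<omega>)) \<partial>P) - (\<integral>\<omega>. Y \<omega> * (g (Y \<omega>) - f (Y \<omega>)) \<partial>P)"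
    unfolding left_diff_distrib using cross by simp
  have "(\<integral>\<omega>. (f (Y \<omega>) + e * (g (Y \<omega>) - f (Y \<omega>))) \<partial>Q) =
      (\<integral>\<omega>. f (Y \<omega>) \<partial>Q) + e * (\<integral>\<omega>. g (Y \<omega>) - f (Y \<omega>) \<partial>Q)"
    "(\<integral>\<omega>. (f (Y \<omega>) + e * (g (Y \<omega>) - f (Y \<omega>))) \<partial>P) =
      (\<integral>\<omega>. f (Y \<omega>) \<partial>P) + e * (\<integral>\<omega>. g (Y \<omega>) - f (Y \<omega>) \<partial>P)"
    by simp_all
  moreover have "(\<integral>\<omega>. (f (Y \<omega>) + e * (g (Y \<omega>) - f (Y \<omega>)))\<^sup>2 \<partial>P) =
      (\<integral>\<omega>. (f (Y \<omega>))\<^sup>2 \<partial>P) + 2 * e * (\<integral>\<omega>. f (Y \<omega>) * (g (Y \<omega>) - f (Y \<omega>)) \<partial>P)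
        + e\<^sup>2 * sq_dist f g"
    unfolding sq sq_dist_def
    by ((subst Bochner_Integration.integral_add;
        (intro Bochner_Integration.integrable_add integrable_mult_right cross
          sq_dist_integrable f g cover_power2_integrable)?)+) simp
  moreover have "(\<integral>\<omega>. Y \<omega> * (f (Y \<omega>) + e * (g (Y \<omega>) - f (Y \<omega>))) \<partial>P) =
      (\<integral>\<omega>. Y \<omega> * f (Y \<omega>) \<partial>P) + e * (\<integral>\<omega>. Y \<omega> * (g (Y \<omega>) - f (Y \<omega>)) \<partial>P)"
    unfolding Ysq by simp
  ultimately show ?thesis
    unfolding J_eq gateaux_def mix by (simp add: algebra_simps)
qed

text \<open>Compare the lower bound \<open>V\<close> with the value at the midpoint of \<open>f\<close> and \<open>g\<close>. Nearly optimal
  indemnities are thereby close to each other in mean square.\<close>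

lemma sq_dist_le_excess:
  assumes f: "f \<in> indemnities" and g: "g \<in> indemnities"
    and V: "\<And>h. h \<in> indemnities \<Longrightarrow> V \<le> J h"
  shows "c / 4 * sq_dist f g \<le> J f + J g - 2 * V"
proof -
  have "J g = J f + gateaux f g + c / 2 * sq_dist f g"
    using objective_segment[OF f g, of 1] by simp
  moreover have "V \<le> J f + gateaux f g / 2 + c / 8 * sq_dist f g"
    using V[OF indemnity_convex[OF f g, of "1/2"]] objective_segment[OF f g, of "1/2"]
    by (simp add: power2_eq_square)
  ultimately show ?thesis by (simp add: field_simps)
qed

lemma prob_Ioc:
  assumes "a < b"
  shows "P.prob {\<omega>\<in>space P. Y \<omega> \<in> {a<..b}} = F b - F a"
proof -
  interpret D: prob_space "distr P borel Y" by (rule P.prob_space_distr[OF Y_measurable])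
  interpret D: finite_borel_measure "distr P borel Y"
    by standard simp
  show ?thesis
    unfolding F_eq D.cdf_diff_eq[OF assms]
    by (subst measure_distr[OF Y_measurable]) (auto intro!: arg_cong[where f = P.prob])
qed

lemma prob_Ioc_pos:
  assumes "0 \<le> a" "a < b"
  shows "0 < P.prob {\<omega>\<in>space P. Y \<omega> \<in> {a<..b}}"
  using assms prob_Ioc[OF assms(2)] F_strict_mono by (simp add: strict_mono_on_def)

lemma Ioc_event: "{\<omega>\<in>space P. Y \<omega> \<in> {a<..b}} \<in> sets P"
  using Y_measurable by measurable

text \<open>A gap of size \<open>e\<close> at \<open>x\<close> can shrink only at unit speed, since both functions have slopes in
  \<open>[0, 1]\<close>; so it is still at least \<open>e / 2\<close> on \<open>(x, x + e / 2]\<close>, an interval of positive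
  probability.\<close>

lemma sq_dist_ge_pointwise:
  assumes f: "f \<in> indemnities" and g: "g \<in> indemnities"
    and x: "0 \<le> x" and e: "0 < e" "e \<le> \<bar>g x - f x\<bar>"
  shows "(e / 2)\<^sup>2 * (F (x + e / 2) - F x) \<le> sq_dist f g"
proof -
  let ?A = "{\<omega>\<in>space P. Y \<omega> \<in> {x<..x + e / 2}}"
  have "(e / 2)\<^sup>2 * (F (x + e / 2) - F x) = (\<integral>\<omega>. (e / 2)\<^sup>2 * indicator ?A \<omega> \<partial>P)"
    using prob_Ioc[of x "x + e / 2"] e Ioc_event by simp
  also have "\<dots> \<le> sq_dist f g"
    unfolding sq_dist_def
  proof (rule integral_mono)
    show "integrable P (\<lambda>\<omega>. (e / 2)\<^sup>2 * indicator ?A \<omega>)"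
      using Ioc_event by (intro integrable_mult_right) (simp add: P.emeasure_eq_measure)
    show "integrable P (\<lambda>\<omega>. (g (Y \<omega>) - f (Y \<omega>))\<^sup>2)" by (rule sq_dist_integrable[OF f g])
    fix \<omega> assume "\<omega> \<in> space P"
    show "(e / 2)\<^sup>2 * indicator ?A \<omega> \<le> (g (Y \<omega>) - f (Y \<omega>))\<^sup>2"
    proof (cases "\<omega> \<in> ?A")
      case True
      then have Y: "x \<le> Y \<omega>" "Y \<omega> \<le> x + e / 2" by auto
      have "e / 2 \<le> \<bar>g (Y \<omega>) - f (Y \<omega>)\<bar>"
        using indemnity_increment[OF f, of x "Y \<omega>"] indemnity_increment[OF g, of x "Y \<omega>"] x e(2) Y
        by linarith
      then show ?thesis using True power_mono[of "e / 2" "\<bar>g (Y \<omega>) - f (Y \<omega>)\<bar>" 2] e by simp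
    qed simp
  qed
  finally show ?thesis .
qed

lemma objective_bounded_below: "bdd_below (J ` indemnities)"
proof -
  have "- (\<bar>1 + \<theta>\<bar> * (\<integral>\<omega>. Y \<omega> \<partial>Q)) - c * (\<integral>\<omega>. (Y \<omega>)\<^sup>2 \<partial>P) - \<bar>lam\<bar> * (\<integral>\<omega>. Y \<omega> \<partial>P) \<le> J f"
    if f: "f \<in> indemnities" for f
  proof -
    have scale: "\<bar>k * A\<bar> \<le> \<bar>k\<bar> * B" if "0 \<le> A" "A \<le> B" for k A B :: real
      using that by (simp add: abs_mult mult_left_mono)
    have 1: "\<bar>(1 + \<theta>) * (\<integral>\<omega>. f (Y \<omega>) \<partial>Q)\<bar> \<le> \<bar>1 + \<theta>\<bar> * (\<integral>\<omega>. Y \<omega> \<partial>Q)"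
      using cover_bounds[OF f] cover_integrable[OF f] Y_integrable
      by (intro scale Bochner_Integration.integral_nonneg integral_mono) (auto simp: space_Q)
    have 2: "\<bar>lam * (\<integral>\<omega>. f (Y \<omega>) \<partial>P)\<bar> \<le> \<bar>lam\<bar> * (\<integral>\<omega>. Y \<omega> \<partial>P)"
      using cover_bounds[OF f] cover_integrable[OF f] Y_integrable
      by (intro scale Bochner_Integration.integral_nonneg integral_mono) auto
    have "(\<integral>\<omega>. Y \<omega> * f (Y \<omega>) \<partial>P) \<le> (\<integral>\<omega>. (Y \<omega>)\<^sup>2 \<partial>P)"
      using cover_bounds[OF f] Y_cover_integrable[OF f] Y_integrable Y_nonneg
      by (auto simp: power2_eq_square intro!: integral_mono mult_left_mono)
    then have 3: "c * (\<integral>\<omega>. Y \<omega> * f (Y \<omega>) \<partial>P) \<le> c * (\<integral>\<omega>. (Y \<omega>)\<^sup>2 \<partial>P)"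
      using c_pos by simp
    have 4: "0 \<le> c / 2 * (\<integral>\<omega>. (f (Y \<omega>))\<^sup>2 \<partial>P)"
      using c_pos by (intro mult_nonneg_nonneg integral_nonneg_AE) auto
    show ?thesis unfolding J_eq using 1 2 3 4 by linarith
  qed
  then show ?thesis by (auto simp: bdd_below_def)
qed

text \<open>All integrands are dominated by \<open>Y\<close> or \<open>Y\<^sup>2\<close>.\<close>

lemma objective_tendsto:
  assumes f: "\<And>n. f n \<in> indemnities" and g: "g \<in> indemnities"
    and lim: "\<And>x. 0 \<le> x \<Longrightarrow> (\<lambda>n. f n x) \<longlonglongrightarrow> g x"
  shows "(\<lambda>n. J (f n)) \<longlonglongrightarrow> J g"
proof -
  have "(\<lambda>n. \<integral>\<omega>. f n (Y \<omega>) \<partial>Q) \<longlonglongrightarrow> (\<integral>\<omega>. g (Y \<omega>) \<partial>Q)"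
    by (rule integral_dominated_convergence[where w = Y])
      (use cover_measurable f g Y_integrable cover_bounds lim Y_nonneg in
        \<open>auto simp: space_Q intro!: AE_I2\<close>)
  moreover have "(\<lambda>n. \<integral>\<omega>. f n (Y \<omega>) \<partial>P) \<longlonglongrightarrow> (\<integral>\<omega>. g (Y \<omega>) \<partial>P)"
    by (rule integral_dominated_convergence[where w = Y])
      (use cover_measurable f g Y_integrable cover_bounds lim Y_nonneg in
        \<open>auto intro!: AE_I2\<close>)
  moreover have "(\<lambda>n. \<integral>\<omega>. (f n (Y \<omega>))\<^sup>2 \<partial>P) \<longlonglongrightarrow> (\<integral>\<omega>. (g (Y \<omega>))\<^sup>2 \<partial>P)"
    by (rule integral_dominated_convergence[where w = "\<lambda>\<omega>. (Y \<omega>)\<^sup>2"])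
      (use cover_measurable f g Y_integrable cover_bounds lim Y_nonneg in
        \<open>auto intro!: AE_I2 tendsto_power power_mono borel_measurable_power\<close>)
  moreover have "(\<lambda>n. \<integral>\<omega>. Y \<omega> * f n (Y \<omega>) \<partial>P) \<longlonglongrightarrow> (\<integral>\<omega>. Y \<omega> * g (Y \<omega>) \<partial>P)"
    by (rule integral_dominated_convergence[where w = "\<lambda>\<omega>. (Y \<omega>)\<^sup>2"])
      (use cover_measurable f g Y_integrable Y_measurable cover_bounds lim Y_nonneg in
        \<open>auto simp: power2_eq_square abs_mult intro!: AE_I2 tendsto_mult mult_mono borel_measurable_times\<close>)
  ultimately show ?thesis unfolding J_eq by (intro tendsto_intros)
qed

text \<open>A minimising sequence is Cauchy in mean square by strong convexity, hence Cauchy at every point;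
  its pointwise limit is the minimiser.\<close>

lemma optimal_exists: "\<exists>I. optimal_indemnity T r \<gamma> \<theta> P Q Y lam t I"
proof -
  define V where "V = Inf (J ` indemnities)"
  have V: "V \<le> J h" if "h \<in> indemnities" for h
    unfolding V_def by (rule cInf_lower[OF _ objective_bounded_below]) (use that in auto)
  have "\<exists>f\<in>indemnities. J f < V + 1 / real (Suc n)" for n
    using cInf_lessD[of "J ` indemnities" "V + 1 / real (Suc n)"] full_cover_indemnity
    unfolding V_def by auto
  then obtain f where f: "\<And>n. f n \<in> indemnities" "\<And>n. J (f n) < V + 1 / real (Suc n)"
    by metis
  have close: "c / 4 * sq_dist (f k) (f l) < 2 / real (Suc N)" if "N \<le> k" "N \<le> l" for N k l
  proof -
    have "c / 4 * sq_dist (f k) (f l) < 1 / real (Suc k) + 1 / real (Suc l)"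
      using sq_dist_le_excess[OF f(1)[of k] f(1)[of l] V] f(2)[of k] f(2)[of l] by linarith
    also have "\<dots> \<le> 1 / real (Suc N) + 1 / real (Suc N)"
      using that by (intro add_mono divide_left_mono) auto
    finally show ?thesis by simp
  qed
  have "Cauchy (\<lambda>n. f n x)" if x: "0 \<le> x" for x
  proof (rule metric_CauchyI)
    fix e :: real assume e: "0 < e"
    define \<delta> where "\<delta> = (e / 2)\<^sup>2 * (F (x + e / 2) - F x)"
    have "F x < F (x + e / 2)" using F_strict_mono x e by (simp add: strict_mono_on_def)
    then have \<delta>: "0 < c / 4 * \<delta> / 2" using e c_pos by (simp add: \<delta>_def)
    then obtain N where N: "1 / real (Suc N) < c / 4 * \<delta> / 2"
      using nat_approx_posE by blast
    show "\<exists>N. \<forall>k\<ge>N. \<forall>l\<ge>N. dist (f k x) (f l x) < e"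
    proof (intro exI allI impI)
      fix k l assume "N \<le> k" "N \<le> l"
      then have "c / 4 * sq_dist (f l) (f k) < c / 4 * \<delta>"
        using close[of N l k] N by simp
      then have "sq_dist (f l) (f k) < \<delta>" using c_pos by simp
      then show "dist (f k x) (f l x) < e"
        using sq_dist_ge_pointwise[OF f(1)[of l] f(1)[of k] x e] unfolding \<delta>_def dist_real_def
        by linarith
    qed
  qed
  then have lim: "(\<lambda>n. f n x) \<longlonglongrightarrow> lim (\<lambda>n. f n x)" if "0 \<le> x" for x
    using that Cauchy_convergent convergent_LIMSEQ_iff by blast
  define I where "I x = lim (\<lambda>n. f n x)" for x
  have lim: "(\<lambda>n. f n x) \<longlonglongrightarrow> I x" if "0 \<le> x" for x
    unfolding I_def by (rule lim[OF that])
  have I: "I \<in> indemnities"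
  proof -
    have "f n 0 = 0" for n using f(1)[of n] by (simp add: indemnities_def)
    then have "I 0 = 0" using lim[of 0] LIMSEQ_const_iff[of 0 "I 0"] by simp
    moreover have "0 \<le> I x" if "0 \<le> x" for x
      by (rule LIMSEQ_le_const[OF lim[OF that]]) (use indemnity_bounds[OF f(1) that] in auto)
    moreover have "0 \<le> I y - I x" "I y - I x \<le> y - x" if xy: "0 \<le> x" "x \<le> y" for x y
    proof -
      have d: "(\<lambda>n. f n y - f n x) \<longlonglongrightarrow> I y - I x"
        using lim xy by (intro tendsto_diff) auto
      show "0 \<le> I y - I x"
        by (rule LIMSEQ_le_const[OF d]) (use indemnity_increment[OF f(1) xy] in auto)
      show "I y - I x \<le> y - x"
        by (rule LIMSEQ_le_const2[OF d]) (use indemnity_increment[OF f(1) xy] in auto)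
    qed
    ultimately show ?thesis by (auto simp: indemnities_def)
  qed
  have "(\<lambda>n. V + 1 / real (Suc n)) \<longlonglongrightarrow> V + 0"
    by (intro tendsto_add tendsto_const LIMSEQ_Suc[OF lim_1_over_n])
  then have "J I \<le> V"
    using LIMSEQ_le[OF objective_tendsto[OF f(1) I lim], of "\<lambda>n. V + 1 / real (Suc n)" V]
      f(2)[THEN less_imp_le] by simp
  then have "J I \<le> J h" if "h \<in> indemnities" for h using V[OF that] by simp
  then show ?thesis
    using I unfolding optimal_indemnity_def is_arg_min_def by (meson not_less)
qed

lemma optimal_gateaux_nonneg:
  assumes opt: "optimal_indemnity T r \<gamma> \<theta> P Q Y lam t I" and g: "g \<in> indemnities"
  shows "0 \<le> gateaux I g"
proof (rule ccontr)
  assume neg: "\<not> ?thesis"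
  have I: "I \<in> indemnities" and min: "\<And>h. h \<in> indemnities \<Longrightarrow> J I \<le> J h"
    using opt unfolding optimal_indemnity_def is_arg_min_def by (auto simp: not_less)
  define A where "A = gateaux I g"
  define B where "B = c / 2 * sq_dist I g"
  have A: "A < 0" using neg by (simp add: A_def)
  have B: "0 \<le> B" using c_pos by (simp add: B_def sq_dist_def)
  \<comment> \<open>A step so short that the quadratic term \<open>e\<^sup>2 B\<close> is at most half of the linear gain \<open>- e A\<close>.\<close>
  define e where "e = min 1 (- A / (2 * (B + 1)))"
  have e: "0 < e" "e \<le> 1" "e \<le> - A / (2 * (B + 1))" using A B by (auto simp: e_def field_simps)
  have "e * B \<le> e * (B + 1)" using e by simp
  also have "\<dots> \<le> - A / 2" using e(3) B by (simp add: field_simps)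
  finally have "A + e * B < 0" using A by simp
  then have "e * (A + e * B) < 0" using e(1) by (rule mult_pos_neg[rotated])
  moreover have "J I \<le> J I + e * A + e\<^sup>2 * B"
    using min[OF indemnity_convex[OF I g, of e]] objective_segment[OF I g, of e] e
    by (simp add: A_def B_def)
  ultimately show False by (simp add: power2_eq_square algebra_simps)
qed

text \<open>The part of \<open>Q\<close> living where \<open>LR = \<infinity>\<close> is invisible to \<open>F\<close>, so the integrand has to vanish there.
  On the remaining set the law of \<open>Y\<close> under \<open>Q\<close> has density \<open>LR\<close>, which is finite almost
  everywhere because it is integrable.\<close>

lemma LR_change_of_measure:
  fixes d :: "real \<Rightarrow> real"
  assumes d: "d \<in> borel_measurable borel" and off: "\<And>x. LR x = \<infinity> \<Longrightarrow> d x = 0"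
  shows "(\<integral>\<omega>. d (Y \<omega>) \<partial>Q) = (\<integral>\<omega>. enn2real (LR (Y \<omega>)) * d (Y \<omega>) \<partial>P)"
    and "integrable Q (\<lambda>\<omega>. d (Y \<omega>)) \<Longrightarrow> integrable P (\<lambda>\<omega>. enn2real (LR (Y \<omega>)) * d (Y \<omega>))"
proof -
  note [measurable] = d Y_measurable Y_measurable_Q
  have LRm[measurable]: "LR \<in> borel_measurable borel"
    and LReq: "\<And>E. E \<in> sets borel \<Longrightarrow>
      emeasure Q {\<omega>\<in>space Q. Y \<omega> \<in> E \<and> LR (Y \<omega>) < \<infinity>} =
      (\<integral>\<^sup>+y. LR y * indicator E y \<partial>distr P borel Y)"
    using LR unfolding likelihood_ratio_def by auto
  let ?N = "distr P borel Y" and ?M = "distr Q borel Y"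
  let ?ind = "\<lambda>x. indicator {x. LR x < \<infinity>} x :: real" and ?lr = "\<lambda>x. enn2real (LR x)"
  have "(\<integral>\<^sup>+y. LR y \<partial>?N) \<noteq> \<infinity>"
    using LReq[of UNIV] Q.emeasure_finite[of "{\<omega>\<in>space Q. LR (Y \<omega>) < \<infinity>}"] by simp
  then have fin: "AE x in ?N. LR x \<noteq> \<infinity>"
    by (intro nn_integral_PInf_AE) simp_all
  have [measurable]: "{x. LR x < \<infinity>} \<in> sets borel" by measurable
  have "density ?M (\<lambda>x. ennreal (?ind x)) = density ?N LR"
  proof (rule measure_eqI)
    fix E assume "E \<in> sets (density ?M (\<lambda>x. ennreal (?ind x)))"
    then have E[measurable]: "E \<in> sets borel" by simp
    have "emeasure (density ?M (\<lambda>x. ennreal (?ind x))) E =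
        (\<integral>\<^sup>+x. indicator ({x. LR x < \<infinity>} \<inter> E) x \<partial>?M)"
    proof -
      have "ennreal (?ind x) * indicator E x = indicator ({x. LR x < \<infinity>} \<inter> E) x" for x
        by (simp add: indicator_def)
      then show ?thesis by (subst emeasure_density) simp_all
    qed
    also have "\<dots> = emeasure ?M ({x. LR x < \<infinity>} \<inter> E)"
      by (intro nn_integral_indicator) simp
    also have "\<dots> = emeasure Q {\<omega>\<in>space Q. Y \<omega> \<in> E \<and> LR (Y \<omega>) < \<infinity>}"
      by (subst emeasure_distr) (auto intro!: arg_cong[where f = "emeasure Q"])
    also have "\<dots> = emeasure (density ?N LR) E"
      unfolding LReq[OF E] by (subst emeasure_density) simp_all
    finally show "emeasure (density ?M (\<lambda>x. ennreal (?ind x))) E = emeasure (density ?N LR) E" .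
  qed simp
  also have "density ?N LR = density ?N (\<lambda>x. ennreal (?lr x))"
    using fin by (intro density_cong) (auto simp: less_top)
  finally have dens: "density ?M (\<lambda>x. ennreal (?ind x)) = density ?N (\<lambda>x. ennreal (?lr x))" .
  have ind: "?ind x * d x = d x" for x
    using off[of x] by (cases "LR x = \<infinity>") (auto simp: less_top)
  have "(\<integral>\<omega>. d (Y \<omega>) \<partial>Q) = (\<integral>x. ?ind x *\<^sub>R d x \<partial>?M)"
    unfolding real_scaleR_def ind by (simp add: integral_distr)
  also have "\<dots> = (\<integral>x. d x \<partial>density ?N (\<lambda>x. ennreal (?lr x)))"
    unfolding dens[symmetric] by (rule integral_density[symmetric]) auto
  also have "\<dots> = (\<integral>x. ?lr x *\<^sub>R d x \<partial>?N)"
    by (rule integral_density) auto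
  finally show "(\<integral>\<omega>. d (Y \<omega>) \<partial>Q) = (\<integral>\<omega>. enn2real (LR (Y \<omega>)) * d (Y \<omega>) \<partial>P)"
    by (simp add: integral_distr)
  assume "integrable Q (\<lambda>\<omega>. d (Y \<omega>))"
  then have "integrable ?M (\<lambda>x. ?ind x *\<^sub>R d x)"
    unfolding real_scaleR_def ind by (subst integrable_distr_eq) simp_all
  then have "integrable (density ?M (\<lambda>x. ennreal (?ind x))) d"
    by (subst integrable_density) auto
  then have "integrable ?N (\<lambda>x. ?lr x *\<^sub>R d x)"
    unfolding dens by (subst (asm) integrable_density) auto
  then show "integrable P (\<lambda>\<omega>. enn2real (LR (Y \<omega>)) * d (Y \<omega>))"
    by (subst (asm) integrable_distr_eq) simp_all
qed

text \<open>With \<open>dQ = LR dF\<close>, the linear terms of the objective combine into the single function \<open>\<phi>\<close>.\<close>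

lemma gateaux_eq:
  assumes f: "f \<in> indemnities" and g: "g \<in> indemnities"
    and off: "\<And>x. 0 \<le> x \<Longrightarrow> LR x = \<infinity> \<Longrightarrow> g x = f x"
  shows "gateaux f g = c * (\<integral>\<omega>. (f (Y \<omega>) - \<phi> (Y \<omega>)) * (g (Y \<omega>) - f (Y \<omega>)) \<partial>P)"
    and "integrable P (\<lambda>\<omega>. (f (Y \<omega>) - \<phi> (Y \<omega>)) * (g (Y \<omega>) - f (Y \<omega>)))"
proof -
  let ?d = "\<lambda>x. g (max x 0) - f (max x 0)"
  let ?D = "\<lambda>\<omega>. g (Y \<omega>) - f (Y \<omega>)" and ?L = "\<lambda>\<omega>. enn2real (LR (Y \<omega>))"
  have d: "?d (Y \<omega>) = ?D \<omega>" if "\<omega> \<in> space P" for \<omega> using Y_nonneg[OF that] by simp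
  have dm: "?d \<in> borel_measurable borel"
    using indemnity_extension_measurable f g by (intro borel_measurable_diff) auto
  have doff: "?d x = 0" if "LR x = \<infinity>" for x
    using off[of x] that f g by (cases "0 \<le> x") (auto simp: indemnities_def)
  have intQ: "integrable Q ?D" using cover_integrable f g by simp
  have "(\<integral>\<omega>. ?D \<omega> \<partial>Q) = (\<integral>\<omega>. ?d (Y \<omega>) \<partial>Q)"
    by (rule Bochner_Integration.integral_cong) (use d in \<open>auto simp: space_Q\<close>)
  also have "\<dots> = (\<integral>\<omega>. ?L \<omega> * ?d (Y \<omega>) \<partial>P)"
    by (rule LR_change_of_measure(1)[OF dm doff])
  also have "\<dots> = (\<integral>\<omega>. ?L \<omega> * ?D \<omega> \<partial>P)"
    by (rule Bochner_Integration.integral_cong) (use d in auto)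
  finally have Q: "(\<integral>\<omega>. ?D \<omega> \<partial>Q) = (\<integral>\<omega>. ?L \<omega> * ?D \<omega> \<partial>P)" .
  have "integrable P (\<lambda>\<omega>. ?L \<omega> * ?d (Y \<omega>))"
  proof (rule LR_change_of_measure(2)[OF dm doff])
    show "integrable Q (\<lambda>\<omega>. ?d (Y \<omega>))"
      by (rule Bochner_Integration.integrable_cong[THEN iffD1, OF refl _ intQ])
        (use d in \<open>auto simp: space_Q\<close>)
  qed
  then have iL: "integrable P (\<lambda>\<omega>. ?L \<omega> * ?D \<omega>)"
    by (rule Bochner_Integration.integrable_cong[THEN iffD1, OF refl, rotated]) (use d in auto)
  have iD: "integrable P ?D" using cover_integrable f g by simp
  have "integrable P (\<lambda>\<omega>. f (Y \<omega>) * g (Y \<omega>) - f (Y \<omega>) * f (Y \<omega>) - (Y \<omega> * g (Y \<omega>) - Y \<omega> * f (Y \<omega>)))"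
    using cover_product_integrable full_cover_indemnity f g
    by (intro Bochner_Integration.integrable_diff) auto
  then have iY: "integrable P (\<lambda>\<omega>. (f (Y \<omega>) - Y \<omega>) * ?D \<omega>)"
    by (simp add: algebra_simps)
  have split: "(f (Y \<omega>) - \<phi> (Y \<omega>)) * ?D \<omega> =
      (f (Y \<omega>) - Y \<omega>) * ?D \<omega> - lam / c * ?D \<omega> + (1 + \<theta>) / c * (?L \<omega> * ?D \<omega>)" for \<omega>
    using c_pos unfolding phi_def c_def[symmetric] by (simp add: field_simps)
  show "integrable P (\<lambda>\<omega>. (f (Y \<omega>) - \<phi> (Y \<omega>)) * ?D \<omega>)"
    unfolding split using iY iD iL by simp
  have eq: "(\<integral>\<omega>. (f (Y \<omega>) - \<phi> (Y \<omega>)) * ?D \<omega> \<partial>P) = (\<integral>\<omega>. (f (Y \<omega>) - Y \<omega>) * ?D \<omega> \<partial>P)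
      - lam / c * (\<integral>\<omega>. ?D \<omega> \<partial>P) + (1 + \<theta>) / c * (\<integral>\<omega>. ?L \<omega> * ?D \<omega> \<partial>P)"
    unfolding split by (simp only: Bochner_Integration.integral_add Bochner_Integration.integral_diff
       Bochner_Integration.integrable_diff integral_mult_right_zero integrable_mult_right iY iD iL)
  have "c * (u - lam / c * v + (1 + \<theta>) / c * w) = (1 + \<theta>) * w + c * u - lam * v" for u v w
    using c_pos by (simp add: field_simps)
  then show "gateaux f g = c * (\<integral>\<omega>. (f (Y \<omega>) - \<phi> (Y \<omega>)) * ?D \<omega> \<partial>P)"
    unfolding gateaux_def Q eq by (rule sym)
qed

text \<open>A continuous nonnegative function that is nonzero somewhere on \<open>S\<close> is positive on an interval, and
  \<open>F\<close> charges that interval.\<close>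

lemma continuous_vanishes_if_integral_nonpos:
  fixes k :: "real \<Rightarrow> real"
  assumes int: "integrable P (\<lambda>\<omega>. k (Y \<omega>))" and le: "(\<integral>\<omega>. k (Y \<omega>) \<partial>P) \<le> 0"
    and nonneg: "\<And>x. 0 \<le> x \<Longrightarrow> 0 \<le> k x"
    and S: "open S" "S \<subseteq> {0..}" and cont: "continuous_on S k" and z: "z \<in> S"
  shows "k z = 0"
proof (rule ccontr)
  assume kz: "k z \<noteq> 0"
  have "AE \<omega> in P. 0 \<le> k (Y \<omega>)" using nonneg Y_nonneg by (intro AE_I2) auto
  then have "AE \<omega> in P. k (Y \<omega>) = 0"
    using integral_nonneg_eq_0_iff_AE[OF int] integral_nonneg_AE[of _ P] le
    by (meson antisym)
  moreover have "open (S \<inter> k -` (- {0}))"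
    by (rule continuous_open_preimage[OF cont S(1)]) auto
  then obtain e where e: "0 < e" "cball z e \<subseteq> S \<inter> k -` (- {0})"
    using open_contains_cball z kz by blast
  have "k x \<noteq> 0" if "x \<in> {z<..z + e}" for x
    using e that by (force simp: dist_real_def)
  ultimately have "AE \<omega> in P. \<omega> \<notin> {\<omega>\<in>space P. Y \<omega> \<in> {z<..z + e}}"
    by (elim eventually_mono) auto
  then have "P.prob {\<omega>\<in>space P. Y \<omega> \<in> {z<..z + e}} = 0"
    using P.prob_eq_0[OF Ioc_event] by blast
  then show False using prob_Ioc_pos[of z "z + e"] z S e by auto
qed

text \<open>The first-order condition for a spliced competitor involves only the values on \<open>S\<close>.
  There the integrand has one sign and is continuous, so it is zero.\<close>

lemma optimal_unimprovable:
  assumes opt: "optimal_indemnity T r \<gamma> \<theta> P Q Y lam t I"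
    and S: "open S" "S \<subseteq> {0<..}" and fin: "\<And>x. x \<in> S \<Longrightarrow> LR x \<noteq> \<infinity>"
    and cont: "continuous_on S \<phi>"
  shows "unimprovable_on S \<phi> I"
  unfolding unimprovable_on_def
proof (intro allI impI ballI)
  fix h z assume h: "splice S h I \<in> indemnities" and z: "z \<in> S"
    and sign: "\<forall>x\<in>S. (I x - \<phi> x) * (h x - I x) \<le> 0"
  let ?g = "splice S h I"
  let ?k = "\<lambda>x. - ((I x - \<phi> x) * (?g x - I x))"
  have I: "I \<in> indemnities" using opt by (simp add: optimal_indemnity_def is_arg_min_def)
  have off: "?g x = I x" if "0 \<le> x" "LR x = \<infinity>" for x using fin that by (auto simp: splice_def)
  have "?k z = 0"
  proof (rule continuous_vanishes_if_integral_nonpos[of ?k S])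
    show "integrable P (\<lambda>\<omega>. ?k (Y \<omega>))" using gateaux_eq(2)[OF I h off] by simp
    show "(\<integral>\<omega>. ?k (Y \<omega>) \<partial>P) \<le> 0"
    proof -
      have "gateaux I ?g = c * (\<integral>\<omega>. (I (Y \<omega>) - \<phi> (Y \<omega>)) * (?g (Y \<omega>) - I (Y \<omega>)) \<partial>P)"
        by (rule gateaux_eq(1)[OF I h]) (rule off)
      then show ?thesis
        using optimal_gateaux_nonneg[OF opt h] c_pos by (simp add: zero_le_mult_iff)
    qed
    show "0 \<le> ?k x" if "0 \<le> x" for x using sign by (auto simp: splice_def)
    have "continuous_on S I" "continuous_on S ?g"
      using indemnity_continuous[OF I] indemnity_continuous[OF h] S(2)
      by (auto elim!: continuous_on_subset)
    then show "continuous_on S ?k" using cont by (intro continuous_intros)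
  qed (use S z in auto)
  then show "(I z - \<phi> z) * (h z - I z) = 0" using z by (simp add: splice_def)
qed

end

section \<open>The partition and the form of the optimal indemnity\<close>

text \<open>Each \<open>y' k\<close> is the left end of a nonempty piece. The frontier of a finite union is covered by the
  frontiers of its members, so \<open>y' k\<close> is an endpoint of one of the sub-intervals of that piece.\<close>

lemma nondiff_points_subset_partition:
  assumes mono: "strict_mono_on {1..n} y'" and img: "y' ` {1..n} = nondiff_points LR F"
    and D: "slope_subdivision g y' n D" and y: "typed_partition g n D m y j"
  shows "nondiff_points LR F \<subseteq> y ` {0..m}"
proof
  fix a assume "a \<in> nondiff_points LR F"
  then obtain k where k: "k \<in> {1..n}" "a = y' k" using img by blast
  let ?U = "open_piece y' n (k + 1)"
  have i: "k + 1 \<in> {1..n + 1}" using k by simp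
  have "a \<in> frontier ?U"
  proof (cases "k + 1 \<le> n")
    case True
    then have "y' k < y' (k + 1)" using mono k by (auto simp: strict_mono_on_def)
    then show ?thesis using True k by (simp add: open_piece_def frontier_def)
  next
    case False
    then show ?thesis using k by (simp add: open_piece_def frontier_def interior_open)
  qed
  moreover have U: "?U = \<Union> (D (k + 1))" and "finite (D (k + 1))"
    using D[unfolded slope_subdivision_def, rule_format, OF i] by (simp_all add: partition_on_def)
  ultimately obtain K where K: "K \<in> D (k + 1)" "a \<in> frontier K"
    using frontier_Union_subset[of "D (k + 1)"] by auto
  have "y ` {0..m} = insert 0 (\<Union>i\<in>{1..n + 1}. \<Union>K\<in>D i. frontier K)"
    using y by (simp add: typed_partition_def)
  then show "a \<in> y ` {0..m}" using i K by blast
qed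

lemma open_piece_avoids_partition_points:
  assumes mono: "strict_mono_on {0..m} y" and i: "i \<in> {1..m + 1}" and x: "x \<in> open_piece y m i"
  shows "x \<notin> y ` {0..m}"
proof
  assume "x \<in> y ` {0..m}"
  then obtain k where k: "k \<in> {0..m}" "x = y k" by blast
  have less: "k < l" if "l \<in> {0..m}" "y k < y l" for l
    using strict_mono_on_less[OF mono k(1) that(1)] that(2) by simp
  have gr: "l < k" if "l \<in> {0..m}" "y l < y k" for l
    using strict_mono_on_less[OF mono that(1) k(1)] that(2) by simp
  show False
    using x k i less[of i] gr[of "i - 1"] diff_le_mono[of i "m + 1" 1] by (auto simp: open_piece_def split: if_splits)
qed

text \<open>By the mean value theorem. The three conclusions are all that the analysis of the pieces has to know
  about the slopes of \<open>\<phi>\<close>.\<close>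

lemma increments_of_slope_range:
  fixes f f' :: "real \<Rightarrow> real"
  assumes deriv: "\<And>x. x \<in> S \<Longrightarrow> (f has_real_derivative f' x) (at x)"
    and range: "\<And>x. x \<in> S \<Longrightarrow> f' x \<in> slope_range j"
    and S: "is_interval S" and xy: "x \<in> S" "y \<in> S" "x < y"
  shows "j = 1 \<Longrightarrow> y - x < f y - f x"
    and "j = 2 \<Longrightarrow> f x \<le> f y \<and> f y - f x \<le> y - x"
    and "j = 3 \<Longrightarrow> f y < f x"
proof -
  have sub: "z \<in> S" if "x \<le> z" "z \<le> y" for z
    using S xy that unfolding is_interval_1 by blast
  obtain z where z: "x < z" "z < y" "f y - f x = (y - x) * f' z"
    using MVT2[OF xy(3), of f f'] deriv sub by blast
  have zr: "f' z \<in> slope_range j" using range sub z by simp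
  show "j = 1 \<Longrightarrow> y - x < f y - f x"
    using zr xy(3) mult_strict_left_mono[of 1 "f' z" "y - x"] by (simp add: z(3) slope_range_def)
  show "j = 2 \<Longrightarrow> f x \<le> f y \<and> f y - f x \<le> y - x"
  proof -
    assume "j = 2"
    then have "0 \<le> (y - x) * f' z" "(y - x) * f' z \<le> (y - x) * 1"
      using zr xy(3) by (auto simp: slope_range_def intro!: mult_nonneg_nonneg mult_left_mono)
    then show ?thesis using z(3) by simp
  qed
  show "j = 3 \<Longrightarrow> f y < f x"
    using zr xy(3) mult_pos_neg[of "y - x" "f' z"] z(3) by (simp add: slope_range_def)
qed

lemma phi_has_derivative:
  assumes "0 < x" "x \<notin> nondiff_points LR F"
  shows "(phi T r \<gamma> \<theta> LR lam t has_real_derivative deriv (phi T r \<gamma> \<theta> LR lam t) x) (at x)"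
proof -
  have "(\<lambda>x. enn2real (LR x)) differentiable (at x within {0..})"
    using assms by (auto simp: nondiff_points_def)
  moreover have "at x within {0..} = at x"
    using assms(1) by (intro at_within_interior) simp
  ultimately obtain d where "((\<lambda>x. enn2real (LR x)) has_real_derivative d) (at x)"
    by (auto simp: real_differentiable_def)
  then have "((\<lambda>x. x + (lam - (1 + \<theta>) * enn2real (LR x)) / (\<gamma> * exp (r * (T - t))))
      has_real_derivative 1 + (0 - (1 + \<theta>) * d) / (\<gamma> * exp (r * (T - t)))) (at x)"
    by (intro DERIV_add DERIV_ident DERIV_cdivide DERIV_diff DERIV_const DERIV_cmult)
  then show ?thesis
    unfolding phi_def[abs_def] by (simp add: DERIV_imp_deriv)
qed

lemma open_piece_open_interval: "open (open_piece p n i)" "is_interval (open_piece p n i)"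
  by (auto simp: open_piece_def is_interval_1)

theorem theorem2:
  fixes T r \<gamma> \<theta> lam t :: real
    and P Q :: "'a measure" and Y :: "'a \<Rightarrow> real"
    and LR :: "real \<Rightarrow> ennreal" and F :: "real \<Rightarrow> real"
    and n m :: nat and y' y :: "nat \<Rightarrow> real" and j :: "nat \<Rightarrow> nat"
    and D :: "nat \<Rightarrow> real set set"
  assumes "T > 0" and "r > 0" and "\<gamma> > 0" and "\<theta> \<ge> 0"
    and "prob_space P" and "prob_space Q" and "sets Q = sets P"
    and "Y \<in> borel_measurable P" and "\<And>\<omega>. \<omega> \<in> space P \<Longrightarrow> 0 \<le> Y \<omega>"
    and "integrable P Y" and "integrable P (\<lambda>\<omega>. (Y \<omega>)\<^sup>2)"
    and "integrable Q Y" and "integrable Q (\<lambda>\<omega>. (Y \<omega>)\<^sup>2)"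
    and F_def: "F = cdf (distr P borel Y)"
    and "strict_mono_on {0..} F"
    and "likelihood_ratio P Q Y LR"
    and "finite_variation LR"
    and nondiff: "y' 0 = 0" "strict_mono_on {1..n} y'" "y' ` {1..n} = nondiff_points LR F"
    and A3: "\<And>\<tau>. \<tau> \<in> {0..T} \<Longrightarrow>
          \<exists>D'. slope_subdivision (deriv (phi T r \<gamma> \<theta> LR lam \<tau>)) y' n D'"
    and "t \<in> {0..T}"
    and "slope_subdivision (deriv (phi T r \<gamma> \<theta> LR lam t)) y' n D"
    and "typed_partition (deriv (phi T r \<gamma> \<theta> LR lam t)) n D m y j"
  shows "(\<exists>I. optimal_indemnity T r \<gamma> \<theta> P Q Y lam t I) \<and>
    (\<forall>I. optimal_indemnity T r \<gamma> \<theta> P Q Y lam t I \<longrightarrow>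
      (j (m + 1) = 1 \<longrightarrow> (\<exists>s\<ge>y m. \<forall>x\<in>piece y m (m + 1).
          I x = I (y m) + max (x - s) 0)) \<and>
      (j (m + 1) = 2 \<longrightarrow> (\<forall>x\<in>piece y m (m + 1).
          I x = min (I (y m) + x - y m) (max (I (y m)) (phi T r \<gamma> \<theta> LR lam t x)))) \<and>
      (j (m + 1) = 3 \<longrightarrow> (\<exists>s\<ge>y m. \<forall>x\<in>piece y m (m + 1).
          I x = I (y m) + layer (y m) s x)) \<and>
      (\<forall>i\<in>{1..m}.
        (j i = 1 \<longrightarrow> (\<exists>s\<in>{y (i - 1)..y i}. \<forall>x\<in>piece y m i.
            I x = I (y (i - 1)) + layer s (s + I (y i) - I (y (i - 1))) x)) \<and>
        (j i = 2 \<longrightarrow> (\<forall>x\<in>piece y m i.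
            I x = min (min (max (max (phi T r \<gamma> \<theta> LR lam t x) (I (y i) + x - y i)) (I (y (i - 1))))
                           (I (y (i - 1)) + x - y (i - 1)))
                      (I (y i)))) \<and>
        (j i = 3 \<longrightarrow> (\<exists>s\<in>{y (i - 1)..y i}. \<forall>x\<in>piece y m i.
            I x = I (y (i - 1)) + x - y (i - 1)
              - layer s (s + y i - y (i - 1) - I (y i) + I (y (i - 1))) x))))"
proof (intro conjI allI impI ballI)
  interpret reinsurance_problem P Q Y LR F T r \<gamma> \<theta> lam t
    using assms by (simp add: reinsurance_problem_def reinsurance_problem_axioms_def)
  show "\<exists>I. optimal_indemnity T r \<gamma> \<theta> P Q Y lam t I" by (rule optimal_exists)
  let ?\<phi> = "phi T r \<gamma> \<theta> LR lam t"
  have y0: "y 0 = 0" and y_mono: "strict_mono_on {0..m} y"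
    and y_type: "\<And>i x. i \<in> {1..m + 1} \<Longrightarrow> x \<in> open_piece y m i \<Longrightarrow> deriv ?\<phi> x \<in> slope_range (j i)"
    using \<open>typed_partition _ n D m y j\<close> unfolding typed_partition_def by blast+
  have y_less: "y (i - 1) < y i" if "i \<in> {1..m}" for i
    using y_mono that by (auto simp: strict_mono_on_def)
  have y_nonneg: "0 \<le> y i" if "i \<in> {0..m}" for i
    using strict_mono_on_leD[OF y_mono, of 0 i] that y0 by simp
  have S_pos: "0 < x" if "i \<in> {1..m + 1}" "x \<in> open_piece y m i" for i x
    using that y_nonneg[of "i - 1"] diff_le_mono[of i "m + 1" 1] by (auto simp: open_piece_def split: if_splits)
  have regular: "x \<notin> nondiff_points LR F" if "i \<in> {1..m + 1}" "x \<in> open_piece y m i" for i x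
    using open_piece_avoids_partition_points[OF y_mono that]
      nondiff_points_subset_partition[OF nondiff(2,3) \<open>slope_subdivision _ y' n D\<close> \<open>typed_partition _ n D m y j\<close>] by blast
  have deriv: "(?\<phi> has_real_derivative deriv ?\<phi> x) (at x)"
    if "i \<in> {1..m + 1}" "x \<in> open_piece y m i" for i x
    by (rule phi_has_derivative[OF S_pos[OF that] regular[OF that]])
  have slope: "j i = 1 \<Longrightarrow> v - u < ?\<phi> v - ?\<phi> u"
    "j i = 2 \<Longrightarrow> ?\<phi> u \<le> ?\<phi> v \<and> ?\<phi> v - ?\<phi> u \<le> v - u"
    "j i = 3 \<Longrightarrow> ?\<phi> v < ?\<phi> u"
    if i: "i \<in> {1..m + 1}" and uv: "u \<in> open_piece y m i" "v \<in> open_piece y m i" "u < v"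
    for i u v
    using increments_of_slope_range[OF deriv[OF i] y_type[OF i] open_piece_open_interval(2) uv]
    by blast+
  fix I assume opt: "optimal_indemnity T r \<gamma> \<theta> P Q Y lam t I"
  then have I: "I \<in> indemnities" by (simp add: optimal_indemnity_def is_arg_min_def)
  have unimprovable: "unimprovable_on (open_piece y m i) ?\<phi> I" if i: "i \<in> {1..m + 1}" for i
  proof (rule optimal_unimprovable[OF opt open_piece_open_interval(1)])
    show "open_piece y m i \<subseteq> {0<..}" using S_pos[OF i] by auto
    show "LR x \<noteq> \<infinity>" if "x \<in> open_piece y m i" for x
      using regular[OF i that] S_pos[OF i that] by (auto simp: nondiff_points_def)
    show "continuous_on (open_piece y m i) ?\<phi>"
      by (rule DERIV_continuous_on[OF has_field_derivative_at_within[OF deriv[OF i]]])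
  qed
  have last: "m + 1 \<in> {1..m + 1}" "m \<in> {0..m}" by simp_all
  have S: "open_piece y m (m + 1) = {y m<..}" "piece y m (m + 1) = {y m..}"
    by (simp_all add: open_piece_def piece_def)
  note unbounded = I y_nonneg[OF last(2)] unimprovable[OF last(1), unfolded S]
  show "\<exists>s\<ge>y m. \<forall>x\<in>piece y m (m + 1). I x = I (y m) + max (x - s) 0" if "j (m + 1) = 1"
    unfolding S(2)
    by (rule unbounded_piece_steep[OF unbounded]) (rule slope(1)[OF last(1)]; simp only: S that)
  show "I x = min (I (y m) + x - y m) (max (I (y m)) (?\<phi> x))"
    if "j (m + 1) = 2" "x \<in> piece y m (m + 1)" for x
    using that(2) unfolding S(2)
    by (rule unbounded_piece_moderate[OF unbounded, rule_format, rotated])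
      (rule slope(2)[OF last(1)]; simp only: S that(1))
  show "\<exists>s\<ge>y m. \<forall>x\<in>piece y m (m + 1). I x = I (y m) + layer (y m) s x" if "j (m + 1) = 3"
    unfolding S(2)
    by (rule unbounded_piece_decreasing[OF unbounded]) (rule slope(3)[OF last(1)]; simp only: S that)
  fix i assume i: "i \<in> {1..m}"
  then have i': "i \<in> {1..m + 1}" "i - 1 \<in> {0..m}" by auto
  have S: "open_piece y m i = {y (i - 1)<..<y i}" "piece y m i = {y (i - 1)..<y i}"
    using i by (simp_all add: open_piece_def piece_def)
  note bounded = I y_nonneg[OF i'(2)] y_less[OF i] unimprovable[OF i'(1), unfolded S]
  show "\<exists>s\<in>{y (i - 1)..y i}. \<forall>x\<in>piece y m i.
      I x = I (y (i - 1)) + layer s (s + I (y i) - I (y (i - 1))) x" if "j i = 1"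
    unfolding S(2)
    by (rule bounded_piece_steep[OF bounded]) (rule slope(1)[OF i'(1)]; simp only: S that)
  show "I x = min (min (max (max (?\<phi> x) (I (y i) + x - y i)) (I (y (i - 1))))
      (I (y (i - 1)) + x - y (i - 1))) (I (y i))"
    if "j i = 2" "x \<in> piece y m i" for x
    using that(2) unfolding S(2)
    by (rule bounded_piece_moderate[OF bounded, rule_format, rotated])
      (rule slope(2)[OF i'(1)]; simp only: S that(1))
  show "\<exists>s\<in>{y (i - 1)..y i}. \<forall>x\<in>piece y m i.
      I x = I (y (i - 1)) + x - y (i - 1)
        - layer s (s + y i - y (i - 1) - I (y i) + I (y (i - 1))) x" if "j i = 3"
    unfolding S(2)
    by (rule bounded_piece_decreasing[OF bounded]) (rule slope(3)[OF i'(1)]; simp only: S that)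
qed

end
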